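(* Let $\phi\colon\mathbb{D}\to\mathbb{D}$ be an analytic self-map. There exists $w\in H^2$ such that the weighted composition operator $M_wC_\phi\colon f\mapsto w\,(f\circ\phi)$ is bounded but not compact on $H^2$ if and only if $\|\phi\|_\infty=\sup_{z\in\mathbb{D}}|\phi(z)|=1$.
   Context: $\mathbb{D}$ is the open unit disk and $H^2$ the Hardy space of $\mathbb{D}$. *)

theory Defs
  imports "HOL-Complex_Analysis.Complex_Analysis"
begin

abbreviation disk :: "complex set" where "disk \<equiv> ball 0 1"

definition taylor_coeff :: "(complex \<Rightarrow> complex) \<Rightarrow> nat \<Rightarrow> complex" where
  "taylor_coeff f n = (deriv ^^ n) f 0 / of_nat (fact n)"

definition H2 :: "(complex \<Rightarrow> complex) set" where
  "H2 = {f. f holomorphic_on disk \<and> summable (\<lambda>n. (cmod (taylor_coeff f n))\<^sup>2)}"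

definition H2_norm :: "(complex \<Rightarrow> complex) \<Rightarrow> real" where
  "H2_norm f = sqrt (\<Sum>n. (cmod (taylor_coeff f n))\<^sup>2)"

definition H2_bounded_op :: "((complex \<Rightarrow> complex) \<Rightarrow> (complex \<Rightarrow> complex)) \<Rightarrow> bool" where
  "H2_bounded_op T \<longleftrightarrow> (\<forall>f\<in>H2. T f \<in> H2) \<and>
     (\<exists>C. \<forall>f\<in>H2. H2_norm (T f) \<le> C * H2_norm f)"

definition H2_compact_op :: "((complex \<Rightarrow> complex) \<Rightarrow> (complex \<Rightarrow> complex)) \<Rightarrow> bool" where
  "H2_compact_op T \<longleftrightarrow> (\<forall>f\<in>H2. T f \<in> H2) \<and>
     (\<forall>f::nat \<Rightarrow> complex \<Rightarrow> complex. (\<forall>n. f n \<in> H2) \<longrightarrow> bounded (range (\<lambda>n. H2_norm (f n))) \<longrightarrow>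
        (\<exists>r g. strict_mono r \<and> g \<in> H2 \<and>
           (\<lambda>n. H2_norm (T (f (r n)) - g)) \<longlonglongrightarrow> 0))"

definition wcomp :: "(complex \<Rightarrow> complex) \<Rightarrow> (complex \<Rightarrow> complex) \<Rightarrow> (complex \<Rightarrow> complex) \<Rightarrow> (complex \<Rightarrow> complex)" where
  "wcomp w \<phi> f = (\<lambda>z. w z * f (\<phi> z))"

end

theory Submission
  imports Defs
begin

text \<open>
  If \<open>sup |\<phi>| < 1\<close>, then a bounded sequence in \<open>H2\<close> has a subsequence converging uniformly on the
  closure of the range of \<open>\<phi>\<close>, so every weighted composition operator is compact.

  Conversely, let \<open>\<zeta>\<close> be a unimodular point of the closure of the range of \<open>\<phi>\<close>, let \<open>\<kappa>\<close> be its
  conjugate and \<open>h = (1 + \<kappa>\<phi>)/2\<close>, a function peaking where \<open>\<phi>\<close> approaches \<open>\<zeta>\<close>. As \<open>\<parallel>h^n\<parallel>\<close> decays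
  subexponentially, the weight \<open>v = h^n/N\<close>, with \<open>N\<close> the norm of \<open>f \<mapsto> h^n (f \<circ> \<phi>)\<close> (finite by Littlewood's
  subordination principle), is for large \<open>n\<close> uniformly small where \<open>\<phi>\<close> is away from \<open>\<zeta>\<close>. One
  multiplies such weights \<open>v j\<close> by squares of bumps \<open>q j = \<delta>/(\<delta> + s) - \<epsilon>/(\<epsilon> + s)\<close>, \<open>s = 1 - \<kappa>z\<close>, which
  live on the shells \<open>\<epsilon> < |s| < \<delta>\<close>; these shrink to \<open>\<zeta>\<close> so fast that \<open>\<Sum>j. |q j|^2\<close> is bounded. With
  \<open>w = \<Sum>j. v j (q j \<circ> \<phi>)^2\<close>, Cauchy-Schwarz decouples both the outputs and the inputs and
  \<open>\<parallel>w (f \<circ> \<phi>)\<parallel>^2 \<le> C \<Sum>j. \<parallel>q j f\<parallel>^2 \<le> C' \<parallel>f\<parallel>^2\<close>. Testing on \<open>q j f j\<close>, where \<open>f j\<close> almost attains the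
  norm for the weight \<open>v j\<close>, shows that the operator is not compact.
\<close>

section \<open>Means over circles\<close>

text \<open>\<open>circlepath 0 r t\<close> is \<open>r\<close> times exp(2 \<pi> i t), so
  integration over the unit interval already gives the mean with respect to normalised arc
  length.\<close>

definition circle_mean :: "real \<Rightarrow> (complex \<Rightarrow> real) \<Rightarrow> real" where
  "circle_mean r F = integral {0..1} (\<lambda>t. F (circlepath 0 r t))"

lemma norm_circlepath [simp]: "0 \<le> r \<Longrightarrow> cmod (circlepath 0 r t) = r"
  by (simp add: circlepath norm_mult)

lemma continuous_on_circlepath: "continuous_on A (circlepath z r)"
  unfolding circlepath by (intro continuous_intros)

lemma continuous_on_circlepath_compose:
  assumes "continuous_on (sphere 0 r) F" "0 \<le> r"
  shows "continuous_on A (\<lambda>t. F (circlepath 0 r t))"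
  by (rule continuous_on_compose2 [OF assms(1) continuous_on_circlepath]) (use assms in auto)

lemma integrable_on_circle:
  fixes F :: "complex \<Rightarrow> 'a::euclidean_space"
  assumes "continuous_on (sphere 0 r) F" "0 \<le> r"
  shows "(\<lambda>t. F (circlepath 0 r t)) integrable_on {0..1}"
  by (intro integrable_continuous_real continuous_on_circlepath_compose assms)

lemma circle_mean_mono:
  assumes "continuous_on (sphere 0 r) F" "continuous_on (sphere 0 r) G" "0 \<le> r"
    and "\<And>z. cmod z = r \<Longrightarrow> F z \<le> G z"
  shows "circle_mean r F \<le> circle_mean r G"
  unfolding circle_mean_def
  by (intro integral_le integrable_on_circle assms) (use assms in auto)

lemma circle_mean_sum:
  assumes "finite I" "\<And>i. i \<in> I \<Longrightarrow> continuous_on (sphere 0 r) (F i)" "0 \<le> r"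
  shows "circle_mean r (\<lambda>z. \<Sum>i\<in>I. F i z) = (\<Sum>i\<in>I. circle_mean r (F i))"
  unfolding circle_mean_def
  by (intro integral_sum integrable_on_circle assms)

lemma circle_mean_cmult: "circle_mean r (\<lambda>z. c * F z) = c * circle_mean r F"
  unfolding circle_mean_def by simp

text \<open>Cauchy's integral formula in the parameter \<open>t\<close>: on a circle about 0 one has
  dz = 2 \<pi> i z dt, which puts \<open>circlepath 0 r t\<close> into the numerator and cancels 2
  \<pi> i.\<close>

lemma cauchy_circle:
  assumes "f holomorphic_on cball 0 r" "cmod w < r"
  shows "((\<lambda>t. circlepath 0 r t / (circlepath 0 r t - w) * f (circlepath 0 r t)) has_integral f w) {0..1}"
proof -
  have "((\<lambda>u. f u/(u-w)) has_contour_integral (2 * of_real pi * \<i> * f w)) (circlepath 0 r)"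
    using assms by (intro Cauchy_integral_circlepath_simple) auto
  then have "((\<lambda>t. f (circlepath 0 r t) / (circlepath 0 r t - w) *
        (2 * pi * \<i> * circlepath 0 r t)) has_integral 2 * of_real pi * \<i> * f w) {0..1}"
    unfolding has_contour_integral vector_derivative_circlepath
    by (simp add: circlepath mult_ac)
  from has_integral_mult_right [OF this, of "1 / (2 * of_real pi * \<i>)"]
  show ?thesis by (simp add: field_simps)
qed

lemma mean_value_circle:
  assumes "f holomorphic_on cball 0 r" "0 < r"
  shows "((\<lambda>t. f (circlepath 0 r t)) has_integral f 0) {0..1}"
proof -
  have nz: "circlepath 0 r t \<noteq> 0" for t
    using norm_circlepath [of r t] assms(2) by force
  show ?thesis
    using cauchy_circle [of f r 0] assms nz by simp
qed

text \<open>On the circle z times its conjugate is \<open>r ^ 2\<close>, so for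
  \<open>n \<le> m\<close> the integrand is a constant times \<open>z ^ (m - n)\<close> and the mean
  value property applies; the other case follows by conjugation.\<close>

lemma circle_monomials_orthogonal:
  assumes "0 < r"
  shows "((\<lambda>t. circlepath 0 r t ^ m * cnj (circlepath 0 r t) ^ n) has_integral
           (if m = n then of_real (r ^ (2 * n)) else 0)) {0..1}"
proof -
  have key: "((\<lambda>t. circlepath 0 r t ^ m * cnj (circlepath 0 r t) ^ n) has_integral
           (if m = n then of_real (r ^ (2 * n)) else 0)) {0..1}" if "n \<le> m" for m n
  proof -
    have eq: "circlepath 0 r t ^ m * cnj (circlepath 0 r t) ^ n
          = of_real (r ^ (2 * n)) * circlepath 0 r t ^ (m - n)" for t
    proof -
      have "circlepath 0 r t ^ m = circlepath 0 r t ^ n * circlepath 0 r t ^ (m - n)"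
        using that by (simp flip: power_add)
      then have "circlepath 0 r t ^ m * cnj (circlepath 0 r t) ^ n
          = (circlepath 0 r t * cnj (circlepath 0 r t)) ^ n * circlepath 0 r t ^ (m - n)"
        by (simp add: power_mult_distrib)
      also have "circlepath 0 r t * cnj (circlepath 0 r t) = of_real (r ^ 2)"
        using assms by (simp only: norm_circlepath less_imp_le flip: complex_norm_square)
      finally show ?thesis by (simp add: power_mult)
    qed
    have "((\<lambda>t. of_real (r ^ (2 * n)) * circlepath 0 r t ^ (m - n)) has_integral
            of_real (r ^ (2 * n)) * 0 ^ (m - n)) {0..1}"
      by (intro has_integral_mult_right mean_value_circle assms) (intro holomorphic_intros)
    then show ?thesis unfolding eq using that by (auto simp: power_0_left)
  qed
  show ?thesis
  proof (cases "n \<le> m")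
    case False
    then have "((\<lambda>t. circlepath 0 r t ^ n * cnj (circlepath 0 r t) ^ m) has_integral 0) {0..1}"
      using key [of m n] by simp
    from has_integral_linear [OF this bounded_linear_cnj] show ?thesis using False by (simp add: o_def mult.commute)
  qed (use key in auto)
qed

lemma circle_mean_polynomial:
  assumes "0 < r"
  shows "circle_mean r (\<lambda>z. (cmod (\<Sum>n<N. a n * z ^ n))\<^sup>2) = (\<Sum>n<N. (cmod (a n))\<^sup>2 * r ^ (2 * n))"
proof -
  let ?z = "circlepath 0 r"
  let ?S = "\<lambda>z. \<Sum>n<N. a n * z ^ n"
  have "((\<lambda>t. \<Sum>m<N. \<Sum>n<N. a m * cnj (a n) * (?z t ^ m * cnj (?z t) ^ n)) has_integral
     (\<Sum>m<N. \<Sum>n<N. a m * cnj (a n) * (if m = n then of_real (r ^ (2 * n)) else 0))) {0..1}"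
    by (intro has_integral_sum has_integral_mult_right circle_monomials_orthogonal assms) auto
  also have "(\<lambda>t. \<Sum>m<N. \<Sum>n<N. a m * cnj (a n) * (?z t ^ m * cnj (?z t) ^ n))
     = (\<lambda>t. ?S (?z t) * cnj (?S (?z t)))"
    by (simp add: sum_product mult_ac)
  also have "\<dots> = (\<lambda>t. complex_of_real ((cmod (?S (?z t)))\<^sup>2))"
    by (simp only: complex_norm_square)
  also have "(\<Sum>m<N. \<Sum>n<N. a m * cnj (a n) * (if m = n then of_real (r ^ (2 * n)) else 0))
     = (\<Sum>m<N. a m * cnj (a m) * of_real (r ^ (2 * m)))"
    by (intro sum.cong refl) (simp add: if_distrib sum.delta cong: if_cong)
  also have "\<dots> = complex_of_real (\<Sum>n<N. (cmod (a n))\<^sup>2 * r ^ (2 * n))"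
    by (simp flip: complex_norm_square)
  finally have "((\<lambda>t. complex_of_real ((cmod (?S (?z t)))\<^sup>2)) has_integral
      complex_of_real (\<Sum>n<N. (cmod (a n))\<^sup>2 * r ^ (2 * n))) {0..1}" .
  from has_integral_linear [OF this bounded_linear_Re]
  have "((\<lambda>t. (cmod (?S (?z t)))\<^sup>2) has_integral (\<Sum>n<N. (cmod (a n))\<^sup>2 * r ^ (2 * n))) {0..1}"
    by (simp only: o_def Re_complex_of_real)
  then show ?thesis
    unfolding circle_mean_def by (rule integral_unique)
qed

text \<open>Orthogonality settles the partial sums, and dominated convergence passes to the limit.
  The coefficients are arbitrary, so that the identity applies to a series without first recognising
  it as a Taylor series.\<close>

lemma parseval_circle:
  assumes sums: "\<And>z. z \<in> disk \<Longrightarrow> (\<lambda>n. a n * z ^ n) sums f z" and r: "0 < r" "r < 1"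
  shows "(\<lambda>n. (cmod (a n))\<^sup>2 * r ^ (2 * n)) sums circle_mean r (\<lambda>z. (cmod (f z))\<^sup>2)"
proof -
  \<comment> \<open>Convergence at a point of modulus between \<open>r\<close> and 1 gives absolute
    convergence at \<open>r\<close>, hence the constant \<open>K\<close> that dominates all partial
    sums on the circle.\<close>
  define \<rho> where "\<rho> = (1 + r) / 2"
  have "cmod (of_real \<rho>) < 1"
    unfolding norm_of_real using r by (simp add: \<rho>_def)
  then have "summable (\<lambda>n. a n * of_real \<rho> ^ n)"
    by (intro sums_summable [OF sums]) simp
  then have summ: "summable (\<lambda>n. norm (a n * of_real r ^ n))"
  proof (rule powser_insidea)
    show "cmod (of_real r) < cmod (of_real \<rho>)"
      unfolding norm_of_real using r by (simp add: \<rho>_def)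
  qed
  define K where "K = (\<Sum>n. norm (a n * of_real r ^ n))"
  have bound: "cmod (\<Sum>n<N. a n * z ^ n) \<le> K" if "cmod z = r" for z N
  proof -
    have "cmod (\<Sum>n<N. a n * z ^ n) \<le> (\<Sum>n<N. norm (a n * of_real r ^ n))"
      by (rule order_trans [OF norm_sum])
        (use r that in \<open>simp add: norm_mult norm_power\<close>)
    also have "\<dots> \<le> K"
      unfolding K_def by (intro sum_le_suminf summ) auto
    finally show ?thesis .
  qed
  have "(\<lambda>N. circle_mean r (\<lambda>z. (cmod (\<Sum>n<N. a n * z ^ n))\<^sup>2))
     \<longlonglongrightarrow> circle_mean r (\<lambda>z. (cmod (f z))\<^sup>2)"
    unfolding circle_mean_def
  proof (rule dominated_convergence(2))
    show "(\<lambda>t. (cmod (\<Sum>n<N. a n * circlepath 0 r t ^ n))\<^sup>2) integrable_on {0..1}" for N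
      using r by (intro integrable_on_circle [where F="\<lambda>z. (cmod (\<Sum>n<N. a n * z ^ n))\<^sup>2"] continuous_intros) auto
    show "(\<lambda>t::real. K\<^sup>2) integrable_on {0..1}"
      by (intro integrable_continuous_real continuous_intros)
    show "norm ((cmod (\<Sum>n<N. a n * circlepath 0 r t ^ n))\<^sup>2) \<le> K\<^sup>2" for N t
      using bound [of "circlepath 0 r t" N] r by (simp add: power_mono)
    show "(\<lambda>N. (cmod (\<Sum>n<N. a n * circlepath 0 r t ^ n))\<^sup>2) \<longlonglongrightarrow> (cmod (f (circlepath 0 r t)))\<^sup>2" for t
      using sums [of "circlepath 0 r t"] r by (intro tendsto_intros) (auto simp: sums_def)
  qed
  then show ?thesis
    by (simp add: sums_def circle_mean_polynomial r)
qed

lemma taylor_sums: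
  assumes "f holomorphic_on disk" "z \<in> disk"
  shows "(\<lambda>n. taylor_coeff f n * z ^ n) sums f z"
  using holomorphic_power_series [OF assms] by (simp add: taylor_coeff_def)

lemma continuous_on_norm_square:
  assumes "f holomorphic_on disk" "r < 1"
  shows "continuous_on (sphere 0 r) (\<lambda>z. (cmod (f z))\<^sup>2)"
  using assms by (intro continuous_intros holomorphic_on_imp_continuous_on holomorphic_on_subset [OF assms(1)]) auto

lemma H2_holomorphic: "f \<in> H2 \<Longrightarrow> f holomorphic_on disk"
  by (simp add: H2_def)

lemma H2_norm_square:
  assumes "f \<in> H2"
  shows "(H2_norm f)\<^sup>2 = (\<Sum>n. (cmod (taylor_coeff f n))\<^sup>2)"
  using assms by (simp add: H2_norm_def H2_def suminf_nonneg)

lemma H2_norm_nonneg: "f \<in> H2 \<Longrightarrow> 0 \<le> H2_norm f"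
  by (simp add: H2_norm_def H2_def suminf_nonneg)

section \<open>The Hardy space through circle means\<close>

lemma circle_mean_le_H2_norm:
  assumes "f \<in> H2" "0 < r" "r < 1"
  shows "circle_mean r (\<lambda>z. (cmod (f z))\<^sup>2) \<le> (H2_norm f)\<^sup>2"
proof -
  have s: "(\<lambda>n. (cmod (taylor_coeff f n))\<^sup>2 * r ^ (2 * n)) sums circle_mean r (\<lambda>z. (cmod (f z))\<^sup>2)"
    using assms by (intro parseval_circle taylor_sums H2_holomorphic)
  have "(\<lambda>n. (cmod (taylor_coeff f n))\<^sup>2) sums (H2_norm f)\<^sup>2"
    using assms by (simp add: H2_norm_square H2_def summable_sums)
  then show ?thesis
    by (rule sums_le [rotated 2, OF _])
       (use assms s in \<open>auto intro!: mult_left_le power_le_one\<close>)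
qed

text \<open>Parseval bounds finitely many coefficients with weights \<open>r ^ (2 * n)\<close>;
  \<open>r\<close> tends to 1 first, then the number of coefficients to infinity. A whole family is
  treated because the gluing needs a bound on a sum of squared norms, which separate bounds on the
  members would not give.\<close>

lemma H2_family_by_means:
  assumes fin: "finite J" and hol: "\<And>j. j \<in> J \<Longrightarrow> X j holomorphic_on disk"
    and B: "\<And>r. 0 < r \<Longrightarrow> r < 1 \<Longrightarrow> (\<Sum>j\<in>J. circle_mean r (\<lambda>z. (cmod (X j z))\<^sup>2)) \<le> B"
  shows "\<And>j. j \<in> J \<Longrightarrow> X j \<in> H2" and "(\<Sum>j\<in>J. (H2_norm (X j))\<^sup>2) \<le> B"
proof -
  let ?a = "\<lambda>j n. (cmod (taylor_coeff (X j) n))\<^sup>2"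
  have part_r: "(\<Sum>j\<in>J. \<Sum>n<N. ?a j n * r ^ (2 * n)) \<le> B" if r: "0 < r" "r < 1" for N r
  proof -
    have "(\<Sum>n<N. ?a j n * r ^ (2 * n)) \<le> circle_mean r (\<lambda>z. (cmod (X j z))\<^sup>2)" if "j \<in> J" for j
      using parseval_circle [OF taylor_sums [OF hol [OF that]] r] r
      unfolding sums_iff by (metis (no_types, lifting) finite_lessThan less_imp_le
          mult_nonneg_nonneg sum_le_suminf zero_le_power zero_le_power2)
    then show ?thesis
      using B [OF r] by (meson order_trans sum_mono)
  qed
  have part: "(\<Sum>j\<in>J. \<Sum>n<N. ?a j n) \<le> B" for N
  proof -
    have "((\<lambda>r. \<Sum>j\<in>J. \<Sum>n<N. ?a j n * r ^ (2 * n)) \<longlongrightarrow> (\<Sum>j\<in>J. \<Sum>n<N. ?a j n * 1 ^ (2 * n))) (at_left 1)"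
      by (intro tendsto_intros)
    moreover have "eventually (\<lambda>r::real. 0 < r \<and> r < 1) (at_left 1)"
      using eventually_at_left_real [of 0 1] by simp
    ultimately show ?thesis
      by (intro tendsto_upperbound [where F="at_left (1::real)" and f="\<lambda>r. \<Sum>j\<in>J. \<Sum>n<N. ?a j n * r ^ (2 * n)"])
         (auto elim!: eventually_mono intro: part_r)
  qed
  have summ: "summable (?a j)" if "j \<in> J" for j
  proof (rule bounded_imp_summable [where B=B])
    fix N
    have "(\<Sum>n\<le>N. ?a j n) \<le> (\<Sum>j\<in>J. \<Sum>n\<le>N. ?a j n)"
      by (rule member_le_sum) (use that fin in \<open>auto intro: sum_nonneg\<close>)
    also have "\<dots> \<le> B" using part [of "Suc N"] by (simp add: lessThan_Suc_atMost)
    finally show "(\<Sum>n\<le>N. ?a j n) \<le> B" .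
  qed auto
  show H: "X j \<in> H2" if "j \<in> J" for j
    using summ hol that by (auto simp: H2_def)
  have "(\<lambda>N. \<Sum>j\<in>J. \<Sum>n<N. ?a j n) \<longlonglongrightarrow> (\<Sum>j\<in>J. (H2_norm (X j))\<^sup>2)"
    by (intro tendsto_sum) (simp add: H2_norm_square H summ summable_LIMSEQ)
  then show "(\<Sum>j\<in>J. (H2_norm (X j))\<^sup>2) \<le> B"
    by (rule LIMSEQ_le_const2) (use part in auto)
qed

text \<open>Integrating a pointwise inequality between sums of squares over circles turns it into
  the same inequality for norms. This stands in for an argument with boundary values.\<close>

lemma H2_family_domination:
  assumes fin: "finite I" "finite J" and F: "\<And>i. i \<in> I \<Longrightarrow> F i \<in> H2"
    and hol: "\<And>j. j \<in> J \<Longrightarrow> X j holomorphic_on disk"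
    and le: "\<And>z. z \<in> disk \<Longrightarrow> (\<Sum>j\<in>J. (cmod (X j z))\<^sup>2) \<le> c * (\<Sum>i\<in>I. (cmod (F i z))\<^sup>2)"
    and c: "0 \<le> c"
  shows "\<And>j. j \<in> J \<Longrightarrow> X j \<in> H2"
    and "(\<Sum>j\<in>J. (H2_norm (X j))\<^sup>2) \<le> c * (\<Sum>i\<in>I. (H2_norm (F i))\<^sup>2)"
proof -
  have B: "(\<Sum>j\<in>J. circle_mean r (\<lambda>z. (cmod (X j z))\<^sup>2)) \<le> c * (\<Sum>i\<in>I. (H2_norm (F i))\<^sup>2)"
    if r: "0 < r" "r < 1" for r
  proof -
    have "(\<Sum>j\<in>J. circle_mean r (\<lambda>z. (cmod (X j z))\<^sup>2)) = circle_mean r (\<lambda>z. \<Sum>j\<in>J. (cmod (X j z))\<^sup>2)"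
      using r by (intro circle_mean_sum [symmetric] fin continuous_on_norm_square hol) auto
    also have "\<dots> \<le> circle_mean r (\<lambda>z. c * (\<Sum>i\<in>I. (cmod (F i z))\<^sup>2))"
      using r by (intro circle_mean_mono continuous_on_sum continuous_on_mult_left continuous_on_norm_square hol le)
         (auto intro: F H2_holomorphic)
    also have "\<dots> = c * (\<Sum>i\<in>I. circle_mean r (\<lambda>z. (cmod (F i z))\<^sup>2))"
      using r by (subst circle_mean_cmult, subst circle_mean_sum)
         (auto intro!: fin continuous_on_norm_square F H2_holomorphic)
    also have "\<dots> \<le> c * (\<Sum>i\<in>I. (H2_norm (F i))\<^sup>2)"
      using r c by (intro mult_left_mono sum_mono circle_mean_le_H2_norm F)
    finally show ?thesis .
  qed
  show "\<And>j. j \<in> J \<Longrightarrow> X j \<in> H2" "(\<Sum>j\<in>J. (H2_norm (X j))\<^sup>2) \<le> c * (\<Sum>i\<in>I. (H2_norm (F i))\<^sup>2)"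
    using H2_family_by_means [OF fin(2) hol B] by auto
qed

lemma H2_domination:
  assumes f: "f \<in> H2" and hol: "g holomorphic_on disk"
    and le: "\<And>z. z \<in> disk \<Longrightarrow> cmod (g z) \<le> M * cmod (f z)" and M: "0 \<le> M"
  shows "g \<in> H2" and "H2_norm g \<le> M * H2_norm f"
proof -
  have le2: "(\<Sum>j\<in>{()}. (cmod (g z))\<^sup>2) \<le> M\<^sup>2 * (\<Sum>i\<in>{()}. (cmod (f z))\<^sup>2)" if "z \<in> disk" for z
    using power_mono [OF le [OF that], of 2] by (simp add: power_mult_distrib)
  note D = H2_family_domination [where I="{()}" and J="{()}" and F="\<lambda>_. f" and X="\<lambda>_. g" and c="M\<^sup>2",
      OF _ _ _ _ le2]
  show "g \<in> H2" using D(1) f hol by simp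
  have "(H2_norm g)\<^sup>2 \<le> (M * H2_norm f)\<^sup>2" using D(2) f hol by (simp add: power_mult_distrib)
  then show "H2_norm g \<le> M * H2_norm f"
    by (rule power2_le_imp_le) (use M f H2_norm_nonneg in auto)
qed

text \<open>Elements of \<open>H2\<close> are total functions with arbitrary values off the disk.
  Mutual domination with constant 1 shows that membership and norm see only the values on the
  disk.\<close>

lemma H2_cong:
  assumes "f \<in> H2" "\<And>z. z \<in> disk \<Longrightarrow> g z = f z"
  shows "g \<in> H2" "H2_norm g = H2_norm f"
proof -
  have hol: "g holomorphic_on disk"
    by (rule holomorphic_transform [OF H2_holomorphic [OF assms(1)]]) (simp add: assms(2))
  show g: "g \<in> H2" using H2_domination(1) [OF assms(1) hol, of 1] assms(2) by simp
  show "H2_norm g = H2_norm f"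
    using H2_domination(2) [OF assms(1) hol, of 1] 
      H2_domination(2) [OF g H2_holomorphic [OF assms(1)], of 1] assms(2) by simp
qed

section \<open>Linear structure of H2 and functions given by power series\<close>

lemma H2_add:
  assumes f: "f \<in> H2" and g: "g \<in> H2"
  shows "(\<lambda>z. f z + g z) \<in> H2" and "H2_norm (\<lambda>z. f z + g z) \<le> H2_norm f + H2_norm g"
proof -
  have L2_le: "L2_set (\<lambda>n. cmod (taylor_coeff h n)) {..<N} \<le> H2_norm h" if "h \<in> H2" for h N
    unfolding L2_set_def H2_norm_def using that by (auto simp: H2_def intro!: sum_le_suminf)
  have hol: "(\<lambda>z. f z + g z) holomorphic_on disk"
    using f g by (intro holomorphic_intros H2_holomorphic)
  have coeff: "taylor_coeff (\<lambda>z. f z + g z) n = taylor_coeff f n + taylor_coeff g n" for n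
    using f g by (simp add: taylor_coeff_def higher_deriv_add [where S=disk] H2_holomorphic add_divide_distrib)
  let ?a = "\<lambda>n. cmod (taylor_coeff (\<lambda>z. f z + g z) n)"
  have L2: "L2_set ?a {..<N} \<le> H2_norm f + H2_norm g" for N
  proof -
    have "L2_set ?a {..<N} \<le> L2_set (\<lambda>n. cmod (taylor_coeff f n) + cmod (taylor_coeff g n)) {..<N}"
      unfolding coeff by (intro L2_set_mono norm_triangle_ineq) auto
    also have "\<dots> \<le> L2_set (\<lambda>n. cmod (taylor_coeff f n)) {..<N} + L2_set (\<lambda>n. cmod (taylor_coeff g n)) {..<N}"
      by (rule L2_set_triangle_ineq)
    also have "\<dots> \<le> H2_norm f + H2_norm g"
      by (intro add_mono L2_le f g)
    finally show ?thesis .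
  qed
  have nn: "0 \<le> H2_norm f + H2_norm g" using f g H2_norm_nonneg by (simp add: add_nonneg_nonneg)
  have part: "(\<Sum>n<N. (?a n)\<^sup>2) \<le> (H2_norm f + H2_norm g)\<^sup>2" for N
    using power_mono [OF L2 [of N], of 2] by (simp add: L2_set_def sum_nonneg)
  have summ: "summable (\<lambda>n. (?a n)\<^sup>2)"
    by (rule bounded_imp_summable [where B="(H2_norm f + H2_norm g)\<^sup>2"])
       (simp, metis part lessThan_Suc_atMost)
  then show "(\<lambda>z. f z + g z) \<in> H2" using hol by (simp add: H2_def)
  show "H2_norm (\<lambda>z. f z + g z) \<le> H2_norm f + H2_norm g"
    unfolding H2_norm_def [of "\<lambda>z. f z + g z"]
    by (intro real_le_lsqrt nn suminf_le_const summ part)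
qed

lemma H2_cmult:
  assumes f: "f \<in> H2"
  shows "(\<lambda>z. c * f z) \<in> H2" and "H2_norm (\<lambda>z. c * f z) \<le> cmod c * H2_norm f"
proof -
  have "(\<lambda>z. c * f z) holomorphic_on disk"
    by (intro holomorphic_intros H2_holomorphic f)
  from H2_domination [OF f this, of "cmod c"]
  show "(\<lambda>z. c * f z) \<in> H2" and "H2_norm (\<lambda>z. c * f z) \<le> cmod c * H2_norm f"
    by (auto simp: norm_mult)
qed

lemma H2_diff:
  assumes f: "f \<in> H2" and g: "g \<in> H2"
  shows "(\<lambda>z. f z - g z) \<in> H2" and "H2_norm (\<lambda>z. f z - g z) \<le> H2_norm f + H2_norm g"
  using H2_add [OF f H2_cmult(1) [OF g, of "-1"]] H2_cmult(2) [OF g, of "-1"] by auto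

lemma H2_sum:
  assumes "finite I" "\<And>i. i \<in> I \<Longrightarrow> F i \<in> H2"
  shows "(\<lambda>z. \<Sum>i\<in>I. F i z) \<in> H2 \<and> H2_norm (\<lambda>z. \<Sum>i\<in>I. F i z) \<le> (\<Sum>i\<in>I. H2_norm (F i))"
  using assms
proof (induction rule: finite_induct)
  case empty
  have "taylor_coeff (\<lambda>z. 0) n = 0" for n
    by (simp add: taylor_coeff_def higher_deriv_const)
  then show ?case by (simp add: H2_def H2_norm_def)
next
  case (insert i I)
  then show ?case
    using H2_add [of "F i" "\<lambda>z. \<Sum>i\<in>I. F i z"] by fastforce
qed

text \<open>Parseval on circles works with the given coefficients directly, so no identification
  with \<open>taylor_coeff f\<close> enters.\<close>

lemma H2_power_series:
  assumes hol: "f holomorphic_on disk" and sums: "\<And>z. z \<in> disk \<Longrightarrow> (\<lambda>n. a n * z ^ n) sums f z"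
    and a: "(\<lambda>n. (cmod (a n))\<^sup>2) sums A"
  shows "f \<in> H2" and "(H2_norm f)\<^sup>2 \<le> A"
proof -
  have "circle_mean r (\<lambda>z. (cmod (f z))\<^sup>2) \<le> A" if r: "0 < r" "r < 1" for r
    by (rule sums_le [OF _ parseval_circle [OF sums r] a])
       (use r in \<open>auto intro!: mult_left_le power_le_one\<close>)
  then show "f \<in> H2" and "(H2_norm f)\<^sup>2 \<le> A"
    using H2_family_by_means [of "{()}" "\<lambda>_. f" A] hol by auto
qed

lemma H2_one: "(\<lambda>z. 1) \<in> H2" "H2_norm (\<lambda>z. 1) \<le> 1"
proof -
  let ?a = "\<lambda>n. if n \<in> {0::nat} then 1 else 0 :: complex"
  have "(\<lambda>n. (cmod (?a n))\<^sup>2) = (\<lambda>n. if n \<in> {0} then 1 else 0)" by auto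
  then have a: "(\<lambda>n. (cmod (?a n))\<^sup>2) sums 1"
    using sums_If_finite_set [of "{0::nat}" "\<lambda>n. 1::real"] by simp
  have "(\<lambda>n. ?a n * z ^ n) = (\<lambda>n. if n \<in> {0} then z ^ n else 0)" for z :: complex by auto
  then have sums: "(\<lambda>n. ?a n * z ^ n) sums 1" for z :: complex
    using sums_If_finite_set [of "{0::nat}" "\<lambda>n. z ^ n"] by simp
  note D = H2_power_series [OF holomorphic_on_const sums a]
  show "(\<lambda>z. 1) \<in> H2" by (rule D(1))
  have "(H2_norm (\<lambda>z. 1))\<^sup>2 \<le> 1\<^sup>2" using D(2) by simp
  then show "H2_norm (\<lambda>z. 1) \<le> 1" by (rule power2_le_imp_le) simp
qed

section \<open>Pointwise bounds and subordination\<close>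

definition poisson_kernel :: "real \<Rightarrow> complex \<Rightarrow> complex \<Rightarrow> real" where
  "poisson_kernel r w \<zeta> = (r\<^sup>2 - (cmod w)\<^sup>2) / (cmod (\<zeta> - w))\<^sup>2"

text \<open>In \<open>w\<close> the right-hand side is the real part of a holomorphic function; this
  gives the kernel the mean value property, also after \<phi> is substituted for
  \<open>w\<close>.\<close>

lemma poisson_kernel_Re:
  assumes "cmod \<zeta> = r"
  shows "poisson_kernel r w \<zeta> = Re ((\<zeta> + w) / (\<zeta> - w))"
proof -
  have "Re ((\<zeta> + w) / (\<zeta> - w)) = Re ((\<zeta> + w) * cnj (\<zeta> - w)) / (cmod (\<zeta> - w))\<^sup>2"
    by (subst complex_div_cnj) (simp add: Re_divide_of_real flip: of_real_power)
  also have "Re ((\<zeta> + w) * cnj (\<zeta> - w)) = (cmod \<zeta>)\<^sup>2 - (cmod w)\<^sup>2"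
    unfolding cmod_power2 by (simp add: algebra_simps power2_eq_square)
  finally show ?thesis using assms by (simp add: poisson_kernel_def)
qed

lemma poisson_kernel_le:
  assumes "cmod \<zeta> = r" "cmod w < r"
  shows "poisson_kernel r w \<zeta> \<le> (r + cmod w) / (r - cmod w)"
proof -
  have "r - cmod w \<le> cmod (\<zeta> - w)"
    using norm_triangle_ineq2 [of \<zeta> w] assms by simp
  then have "(r - cmod w)\<^sup>2 \<le> (cmod (\<zeta> - w))\<^sup>2"
    using assms by (intro power_mono) auto
  then have "poisson_kernel r w \<zeta> \<le> (r\<^sup>2 - (cmod w)\<^sup>2) / (r - cmod w)\<^sup>2"
    unfolding poisson_kernel_def using assms
    by (intro divide_left_mono mult_pos_pos) (auto intro!: power_mono)
  also have "\<dots> = (r + cmod w) / (r - cmod w)"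
    using assms square_diff_square_factored [of r "cmod w"] by (simp add: power2_eq_square)
  finally show ?thesis .
qed

text \<open>Subharmonicity of |f|^2: Cauchy's formula for a modification of the square of
  \<open>f\<close>, followed by the triangle inequality under the integral.\<close>

lemma norm_square_le_poisson_mean:
  assumes f: "f holomorphic_on disk" and r: "cmod w < r" "r < 1"
  shows "(cmod (f w))\<^sup>2 \<le> circle_mean r (\<lambda>\<zeta>. poisson_kernel r w \<zeta> * (cmod (f \<zeta>))\<^sup>2)"
proof -
  have r0: "0 < r" using r norm_ge_zero [of w] by linarith
  \<comment> \<open>The extra factor is \<open>1\<close> at \<open>w\<close> and turns the modulus of the Cauchy kernel into the Poisson kernel.\<close>
  define F where "F = (\<lambda>\<zeta>. (f \<zeta>)\<^sup>2 * (of_real (r\<^sup>2 - (cmod w)\<^sup>2) / (of_real (r\<^sup>2) - cnj w * \<zeta>)))"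
  have w2: "(cmod w)\<^sup>2 < r\<^sup>2" using r by (intro power_strict_mono) auto
  \<comment> \<open>The only possible pole of the extra factor is the reflection of \<open>w\<close>
    in the circle, which lies outside the closed disk of radius \<open>r\<close>.\<close>
  have nz: "of_real (r\<^sup>2) - cnj w * \<zeta> \<noteq> 0" if "cmod \<zeta> \<le> r" for \<zeta>
  proof
    assume "of_real (r\<^sup>2) - cnj w * \<zeta> = 0"
    then have "cmod (of_real (r\<^sup>2)) = cmod w * cmod \<zeta>"
      by (metis complex_mod_cnj eq_iff_diff_eq_0 norm_mult)
    also have "\<dots> \<le> cmod w * r" using that by (intro mult_left_mono) auto
    also have "\<dots> < r * r" using r r0 by simp
    finally show False by (simp only: norm_of_real power2_eq_square)
  qed
  have "F holomorphic_on cball 0 r"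
    unfolding F_def using nz r by (intro holomorphic_intros holomorphic_on_subset [OF f]) auto
  from cauchy_circle [OF this r(1)]
  have I: "((\<lambda>t. circlepath 0 r t / (circlepath 0 r t - w) * F (circlepath 0 r t)) has_integral F w) {0..1}" .
  have eq: "cmod (\<zeta> / (\<zeta> - w) * F \<zeta>) = poisson_kernel r w \<zeta> * (cmod (f \<zeta>))\<^sup>2" if "cmod \<zeta> = r" for \<zeta>
  proof -
    have "of_real (r\<^sup>2) - cnj w * \<zeta> = \<zeta> * cnj (\<zeta> - w)"
      using complex_norm_square [of \<zeta>] that by (simp add: algebra_simps)
    then have "cmod (of_real (r\<^sup>2) - cnj w * \<zeta>) = r * cmod (\<zeta> - w)"
      using that by (simp add: norm_mult del: complex_cnj_diff)
    then show ?thesis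
      using r0 that w2 unfolding F_def poisson_kernel_def norm_mult norm_divide norm_power norm_of_real
      by (simp add: power2_eq_square)
  qed
  have ne: "\<zeta> \<noteq> w" if "cmod \<zeta> = r" for \<zeta> using that r by auto
  have Fw: "F w = (f w)\<^sup>2"
    using nz [of w] r complex_norm_square [of w] by (simp add: F_def mult.commute)
  have "(cmod (f w))\<^sup>2 = cmod (integral {0..1} (\<lambda>t. circlepath 0 r t / (circlepath 0 r t - w) * F (circlepath 0 r t)))"
    using integral_unique [OF I] by (simp add: Fw norm_power)
  also have "\<dots> \<le> integral {0..1} (\<lambda>t. poisson_kernel r w (circlepath 0 r t) * (cmod (f (circlepath 0 r t)))\<^sup>2)"
  proof (rule integral_norm_bound_integral)
    show "(\<lambda>t. circlepath 0 r t / (circlepath 0 r t - w) * F (circlepath 0 r t)) integrable_on {0..1}"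
      using I by (rule has_integral_integrable)
    show "(\<lambda>t. poisson_kernel r w (circlepath 0 r t) * (cmod (f (circlepath 0 r t)))\<^sup>2) integrable_on {0..1}"
      unfolding poisson_kernel_def
      by (intro integrable_on_circle [where F="\<lambda>\<zeta>. (r\<^sup>2 - (cmod w)\<^sup>2) / (cmod (\<zeta> - w))\<^sup>2 * (cmod (f \<zeta>))\<^sup>2"]
            continuous_intros continuous_on_norm_square f) (use ne r r0 in auto)
  qed (use eq r0 in \<open>simp add: less_imp_le\<close>)
  finally show ?thesis by (simp add: circle_mean_def)
qed

text \<open>The Poisson mean is taken on the circle halfway between |w| and 1, where Harnack's bound
  (r + |w|) / (r - |w|) for the kernel is at most 4 / (1 - |w|).\<close>

lemma H2_pointwise_bound:
  assumes f: "f \<in> H2" and w: "w \<in> disk"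
  shows "(cmod (f w))\<^sup>2 \<le> 4 / (1 - cmod w) * (H2_norm f)\<^sup>2"
proof -
  define r where "r = (1 + cmod w) / 2"
  have r: "cmod w < r" "r < 1" "0 < r"
    using w norm_ge_zero [of w] unfolding r_def by (auto simp del: norm_ge_zero) 
  have ne: "\<zeta> \<noteq> w" if "cmod \<zeta> = r" for \<zeta> using that r by auto
  have "(cmod (f w))\<^sup>2 \<le> circle_mean r (\<lambda>\<zeta>. poisson_kernel r w \<zeta> * (cmod (f \<zeta>))\<^sup>2)"
    by (intro norm_square_le_poisson_mean H2_holomorphic f r)
  also have "\<dots> \<le> circle_mean r (\<lambda>\<zeta>. (r + cmod w) / (r - cmod w) * (cmod (f \<zeta>))\<^sup>2)"
  proof (rule circle_mean_mono)
    show "continuous_on (sphere 0 r) (\<lambda>\<zeta>. poisson_kernel r w \<zeta> * (cmod (f \<zeta>))\<^sup>2)"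
      unfolding poisson_kernel_def
      by (intro continuous_intros continuous_on_norm_square H2_holomorphic f) (use ne r in auto)
    show "continuous_on (sphere 0 r) (\<lambda>\<zeta>. (r + cmod w) / (r - cmod w) * (cmod (f \<zeta>))\<^sup>2)"
      by (intro continuous_on_mult_left continuous_on_norm_square H2_holomorphic f r)
    show "poisson_kernel r w \<zeta> * (cmod (f \<zeta>))\<^sup>2 \<le> (r + cmod w) / (r - cmod w) * (cmod (f \<zeta>))\<^sup>2"
      if "cmod \<zeta> = r" for \<zeta>
      using that r by (intro mult_right_mono poisson_kernel_le) auto
  qed (use r in auto)
  also have "\<dots> = (r + cmod w) / (r - cmod w) * circle_mean r (\<lambda>\<zeta>. (cmod (f \<zeta>))\<^sup>2)"
    by (rule circle_mean_cmult)
  also have "\<dots> \<le> (r + cmod w) / (r - cmod w) * (H2_norm f)\<^sup>2"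
    using r by (intro mult_left_mono circle_mean_le_H2_norm f) auto
  also have "\<dots> \<le> 4 / (1 - cmod w) * (H2_norm f)\<^sup>2"
  proof (rule mult_right_mono)
    have "r + cmod w \<le> 2" "r - cmod w = (1 - cmod w) / 2"
      using w by (auto simp: r_def field_simps)
    then have "(r + cmod w) / (r - cmod w) \<le> 2 / ((1 - cmod w) / 2)"
      by (intro frac_le) (use w in auto)
    then show "(r + cmod w) / (r - cmod w) \<le> 4 / (1 - cmod w)" by simp
  qed auto
  finally show ?thesis .
qed

lemma circle_mean_poisson_kernel:
  assumes \<phi>: "\<phi> holomorphic_on cball 0 r" and \<rho>: "\<And>z. cmod z \<le> r \<Longrightarrow> cmod (\<phi> z) < \<rho>"
    and "0 < r" "cmod \<zeta> = \<rho>"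
  shows "circle_mean r (\<lambda>z. poisson_kernel \<rho> (\<phi> z) \<zeta>) = poisson_kernel \<rho> (\<phi> 0) \<zeta>"
proof -
  have "(\<lambda>z. (\<zeta> + \<phi> z) / (\<zeta> - \<phi> z)) holomorphic_on cball 0 r"
    using \<rho> assms by (intro holomorphic_intros) auto
  from has_integral_linear [OF mean_value_circle [OF this \<open>0 < r\<close>] bounded_linear_Re]
  show ?thesis
    unfolding circle_mean_def poisson_kernel_Re [OF \<open>cmod \<zeta> = \<rho>\<close>] o_def by (rule integral_unique)
qed

text \<open>Bound |f|^2 at \<open>\<phi> z\<close> by its Poisson mean over a circle of radius
  \<rho>, average over \<open>z\<close> and exchange the integrals. The mean of the kernel over
  \<open>z\<close> is its value at \<open>\<phi> 0\<close>, which Harnack's inequality bounds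
  independently of the radii.\<close>

theorem littlewood_subordination:
  assumes \<phi>: "\<phi> holomorphic_on disk" "\<phi> ` disk \<subseteq> disk" and f: "f \<in> H2"
  shows "(\<lambda>z. f (\<phi> z)) \<in> H2" and "(H2_norm (\<lambda>z. f (\<phi> z)))\<^sup>2 \<le> 4 / (1 - cmod (\<phi> 0)) * (H2_norm f)\<^sup>2"
proof -
  have \<phi>1: "cmod (\<phi> z) < 1" if "cmod z < 1" for z
    using \<phi>(2) that by (auto simp: image_subset_iff)
  have hol: "(\<lambda>z. f (\<phi> z)) holomorphic_on disk"
    using holomorphic_on_compose_gen [OF \<phi>(1) H2_holomorphic [OF f] \<phi>(2)] by (simp add: o_def)
  have B: "circle_mean r (\<lambda>z. (cmod (f (\<phi> z)))\<^sup>2) \<le> 4 / (1 - cmod (\<phi> 0)) * (H2_norm f)\<^sup>2"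
    if r: "0 < r" "r < 1" for r
  proof -
    have sub: "cball 0 r \<subseteq> disk" using r by auto
    have \<phi>r: "\<phi> holomorphic_on cball 0 r"
      using holomorphic_on_subset [OF \<phi>(1) sub] .
    have "compact ((\<lambda>z. cmod (\<phi> z)) ` cball 0 r)"
      by (intro compact_continuous_image continuous_intros holomorphic_on_imp_continuous_on \<phi>r) auto
    then obtain z1 where z1: "z1 \<in> cball 0 r" "\<And>z. z \<in> cball 0 r \<Longrightarrow> cmod (\<phi> z) \<le> cmod (\<phi> z1)"
      using compact_attains_sup [of "(\<lambda>z. cmod (\<phi> z)) ` cball 0 r"] r by fastforce
    \<comment> \<open>Larger than all |\<phi> z| with |z| \<le> r, so the kernel has no singularity,
      and less than 1. As |\<phi> 0| \<le> |\<phi> z1|, the midpoint gives \<rho> - |\<phi> 0| \<ge>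
      (1 - |\<phi> 0|) / 2, which makes the final constant independent of \<open>r\<close>.\<close>
    define \<rho> where "\<rho> = (1 + cmod (\<phi> z1)) / 2"
    have m1: "cmod (\<phi> z1) < 1" using z1(1) r \<phi>1 by simp
    have \<rho>: "0 < \<rho>" "\<rho> < 1" "cmod (\<phi> z1) < \<rho>"
      using m1 norm_ge_zero [of "\<phi> z1"] unfolding \<rho>_def by (auto simp del: norm_ge_zero)
    have \<phi>\<rho>: "cmod (\<phi> z) < \<rho>" if "cmod z \<le> r" for z
      using z1(2) [of z] that \<rho> by simp
    have ne: "\<zeta> \<noteq> \<phi> z" if "cmod z \<le> r" "cmod \<zeta> = \<rho>" for z \<zeta>
      using \<phi>\<rho> [OF that(1)] that by auto
    let ?K = "\<lambda>z \<zeta>. poisson_kernel \<rho> (\<phi> z) \<zeta> * (cmod (f \<zeta>))\<^sup>2"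
    \<comment> \<open>Joint continuity serves twice: for continuity of the inner mean in
      \<open>z\<close> and for the exchange of the integrals.\<close>
    have cont: "continuous_on (sphere 0 r \<times> UNIV) (\<lambda>(z, t). ?K z (circlepath 0 \<rho> t))"
    proof -
      have c\<phi>: "continuous_on (sphere 0 r \<times> UNIV) (\<lambda>p::complex\<times>real. \<phi> (fst p))"
        by (rule continuous_on_compose2 [OF holomorphic_on_imp_continuous_on [OF \<phi>r]])
           (auto intro!: continuous_intros)
      have cz: "continuous_on (sphere 0 r \<times> UNIV) (\<lambda>p::complex\<times>real. circlepath 0 \<rho> (snd p))"
        by (rule continuous_on_compose2 [OF continuous_on_circlepath [where A=UNIV]])
           (auto intro!: continuous_intros)
      have cf: "continuous_on (sphere 0 r \<times> UNIV) (\<lambda>p::complex\<times>real. f (circlepath 0 \<rho> (snd p)))"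
        by (rule continuous_on_compose2 [OF holomorphic_on_imp_continuous_on [OF H2_holomorphic [OF f]] cz])
           (use \<rho> in auto)
      show ?thesis
        unfolding poisson_kernel_def case_prod_unfold
        by (intro continuous_intros c\<phi> cf cz) (use ne r \<rho> in \<open>auto simp: less_imp_le\<close>)
    qed
    have contz: "continuous_on (sphere 0 r) (\<lambda>z. circle_mean \<rho> (?K z))"
      unfolding circle_mean_def
      using integral_continuous_on_param [of "sphere 0 r" 0 1 "\<lambda>z t. ?K z (circlepath 0 \<rho> t)"]
        continuous_on_subset [OF cont, of "sphere 0 r \<times> {0..1}"] by auto
    have cont2: "continuous_on (cbox (0, 0) (1, 1)) (\<lambda>(s, t). ?K (circlepath 0 r s) (circlepath 0 \<rho> t))"
    proof -
      have "continuous_on (cbox (0, 0) (1, 1)) (\<lambda>p::real\<times>real. (circlepath 0 r (fst p), snd p))"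
        by (intro continuous_intros continuous_on_compose2 [OF continuous_on_circlepath [where A=UNIV]]) auto
      from continuous_on_compose2 [OF cont this] show ?thesis
        using r by (force simp: case_prod_unfold)
    qed
    have "circle_mean r (\<lambda>z. (cmod (f (\<phi> z)))\<^sup>2) \<le> circle_mean r (\<lambda>z. circle_mean \<rho> (?K z))"
      using r \<rho> by (intro circle_mean_mono contz continuous_on_norm_square hol norm_square_le_poisson_mean
           H2_holomorphic f \<phi>\<rho>) auto
    also have "\<dots> = circle_mean \<rho> (\<lambda>\<zeta>. circle_mean r (\<lambda>z. ?K z \<zeta>))"
      unfolding circle_mean_def
      using integral_swap_continuous [OF cont2] by simp
    also have "\<dots> = circle_mean \<rho> (\<lambda>\<zeta>. ?K 0 \<zeta>)"
    proof -
      have "circle_mean r (\<lambda>z. ?K z \<zeta>) = ?K 0 \<zeta>" if "cmod \<zeta> = \<rho>" for \<zeta>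
        using circle_mean_poisson_kernel [OF \<phi>r \<phi>\<rho> r(1) that]
          circle_mean_cmult [of r "(cmod (f \<zeta>))\<^sup>2" "\<lambda>z. poisson_kernel \<rho> (\<phi> z) \<zeta>"]
        by (simp add: mult.commute)
      then show ?thesis using \<rho> by (simp add: circle_mean_def [of \<rho>] less_imp_le)
    qed
    also have "\<dots> \<le> circle_mean \<rho> (\<lambda>\<zeta>. (\<rho> + cmod (\<phi> 0)) / (\<rho> - cmod (\<phi> 0)) * (cmod (f \<zeta>))\<^sup>2)"
    proof (rule circle_mean_mono)
      show "continuous_on (sphere 0 \<rho>) (?K 0)"
        unfolding poisson_kernel_def
        by (intro continuous_intros continuous_on_norm_square H2_holomorphic f) (use ne [of 0] r \<rho> in auto)
      show "continuous_on (sphere 0 \<rho>) (\<lambda>\<zeta>. (\<rho> + cmod (\<phi> 0)) / (\<rho> - cmod (\<phi> 0)) * (cmod (f \<zeta>))\<^sup>2)"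
        by (intro continuous_on_mult_left continuous_on_norm_square H2_holomorphic f \<rho>)
      show "?K 0 \<zeta> \<le> (\<rho> + cmod (\<phi> 0)) / (\<rho> - cmod (\<phi> 0)) * (cmod (f \<zeta>))\<^sup>2" if "cmod \<zeta> = \<rho>" for \<zeta>
        using that r \<phi>\<rho> [of 0] by (intro mult_right_mono poisson_kernel_le) auto
    qed (use \<rho> in auto)
    also have "\<dots> = (\<rho> + cmod (\<phi> 0)) / (\<rho> - cmod (\<phi> 0)) * circle_mean \<rho> (\<lambda>\<zeta>. (cmod (f \<zeta>))\<^sup>2)"
      by (rule circle_mean_cmult)
    also have "\<dots> \<le> (\<rho> + cmod (\<phi> 0)) / (\<rho> - cmod (\<phi> 0)) * (H2_norm f)\<^sup>2"
      using r \<rho> \<phi>\<rho> [of 0] by (intro mult_left_mono circle_mean_le_H2_norm f divide_nonneg_nonneg) auto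
    also have "\<dots> \<le> 4 / (1 - cmod (\<phi> 0)) * (H2_norm f)\<^sup>2"
    proof (rule mult_right_mono)
      have "cmod (\<phi> 0) \<le> cmod (\<phi> z1)" using z1(2) [of 0] r by simp
      then have *: "\<rho> + cmod (\<phi> 0) \<le> 2" "(1 - cmod (\<phi> 0)) / 2 \<le> \<rho> - cmod (\<phi> 0)" "cmod (\<phi> 0) < 1"
        using m1 by (auto simp: \<rho>_def field_simps)
      have "(\<rho> + cmod (\<phi> 0)) / (\<rho> - cmod (\<phi> 0)) \<le> 2 / ((1 - cmod (\<phi> 0)) / 2)"
        by (rule frac_le) (use * in auto)
      then show "(\<rho> + cmod (\<phi> 0)) / (\<rho> - cmod (\<phi> 0)) \<le> 4 / (1 - cmod (\<phi> 0))"
        by simp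
    qed auto
    finally show ?thesis .
  qed
  then show "(\<lambda>z. f (\<phi> z)) \<in> H2" 
    and "(H2_norm (\<lambda>z. f (\<phi> z)))\<^sup>2 \<le> 4 / (1 - cmod (\<phi> 0)) * (H2_norm f)\<^sup>2"
    using H2_family_by_means [of "{()}" "\<lambda>_ z. f (\<phi> z)" "4 / (1 - cmod (\<phi> 0)) * (H2_norm f)\<^sup>2"] hol
    by auto
qed

corollary composition_norm_le:
  assumes \<phi>: "\<phi> holomorphic_on disk" "\<phi> ` disk \<subseteq> disk" and f: "f \<in> H2"
  shows "H2_norm (\<lambda>z. f (\<phi> z)) \<le> sqrt (4 / (1 - cmod (\<phi> 0))) * H2_norm f"
proof -
  have "cmod (\<phi> 0) < 1" using \<phi>(2) by (auto simp: image_subset_iff)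
  then have "(H2_norm (\<lambda>z. f (\<phi> z)))\<^sup>2 \<le> (sqrt (4 / (1 - cmod (\<phi> 0))) * H2_norm f)\<^sup>2"
    using littlewood_subordination(2) [OF \<phi> f] by (simp add: power_mult_distrib)
  then show ?thesis
    by (rule power2_le_imp_le) (use \<open>cmod (\<phi> 0) < 1\<close> f H2_norm_nonneg in auto)
qed

section \<open>Normal families and a Fatou property\<close>

lemma H2_locally_bounded:
  assumes "compact K" "K \<subseteq> disk"
  obtains M where "0 \<le> M" "\<And>f z. f \<in> H2 \<Longrightarrow> z \<in> K \<Longrightarrow> cmod (f z) \<le> M * H2_norm f"
proof -
  have "\<exists>\<rho><1. \<forall>z\<in>K. cmod z \<le> \<rho>"
  proof (cases "K = {}")
    case True
    then show ?thesis by (intro exI [of _ 0]) auto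
  next
    case False
    then obtain x where "x \<in> K" "\<forall>z\<in>K. cmod z \<le> cmod x"
      using continuous_attains_sup [OF assms(1) False, of cmod] by (auto intro: continuous_intros)
    then show ?thesis using assms(2) by (intro exI [of _ "cmod x"]) auto
  qed
  then obtain \<rho> where \<rho>: "\<rho> < 1" "\<And>z. z \<in> K \<Longrightarrow> cmod z \<le> \<rho>" by blast
  define M where "M = sqrt (4 / (1 - \<rho>))"
  have M: "0 \<le> M" using \<rho> by (simp add: M_def)
  have "cmod (f z) \<le> M * H2_norm f" if "f \<in> H2" "z \<in> K" for f z
  proof (rule power2_le_imp_le)
    have "(cmod (f z))\<^sup>2 \<le> 4 / (1 - cmod z) * (H2_norm f)\<^sup>2"
      using that assms by (intro H2_pointwise_bound) auto
    also have "\<dots> \<le> 4 / (1 - \<rho>) * (H2_norm f)\<^sup>2"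
      using \<rho>(2) [OF that(2)] \<rho>(1) by (intro mult_right_mono divide_left_mono mult_pos_pos) auto
    finally show "(cmod (f z))\<^sup>2 \<le> (M * H2_norm f)\<^sup>2"
      using \<rho> by (simp add: power_mult_distrib M_def)
  qed (use M that H2_norm_nonneg in auto)
  then show ?thesis using M that by blast
qed

lemma H2_montel:
  assumes F: "\<And>n. F n \<in> H2" and B: "\<And>n. H2_norm (F n) \<le> B"
  obtains g r where "g holomorphic_on disk" "strict_mono (r :: nat \<Rightarrow> nat)"
    "\<And>z. z \<in> disk \<Longrightarrow> (\<lambda>n. F (r n) z) \<longlonglongrightarrow> g z"
    "\<And>K. compact K \<Longrightarrow> K \<subseteq> disk \<Longrightarrow> uniform_limit K (F \<circ> r) g sequentially"
proof -
  have bdd: "\<exists>C. \<forall>h\<in>range F. \<forall>z\<in>K. cmod (h z) \<le> C" if K: "compact K" "K \<subseteq> disk" for K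
  proof -
    obtain M where M: "0 \<le> M" "\<And>f z. f \<in> H2 \<Longrightarrow> z \<in> K \<Longrightarrow> cmod (f z) \<le> M * H2_norm f"
      using H2_locally_bounded [OF K] by blast
    have "cmod (F n z) \<le> M * B" if "z \<in> K" for n z
      using M(2) [OF F that, of n] mult_left_mono [OF B M(1), of n] by linarith
    then show ?thesis by auto
  qed
  have hol: "h holomorphic_on disk" if "h \<in> range F" for h
    using that F H2_holomorphic by auto
  show thesis
    by (rule Montel [OF open_ball hol bdd subset_refl]) (assumption | rule that)+
qed

text \<open>Montel's theorem supplies holomorphy of the pointwise limit; the norm bound comes from
  dominated convergence on each circle. The lemma later carries estimates for finite sums of weights
  over to the infinite sum.\<close>

lemma H2_fatou:
  assumes F: "\<And>n. F n \<in> H2" and B: "\<And>n. H2_norm (F n) \<le> B"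
    and lim: "\<And>z. z \<in> disk \<Longrightarrow> (\<lambda>n. F n z) \<longlonglongrightarrow> f z"
  shows "f \<in> H2" and "H2_norm f \<le> B"
proof -
  obtain g r where g: "g holomorphic_on disk" "strict_mono (r :: nat \<Rightarrow> nat)"
    "\<And>z. z \<in> disk \<Longrightarrow> (\<lambda>n. F (r n) z) \<longlonglongrightarrow> g z"
    "\<And>K. compact K \<Longrightarrow> K \<subseteq> disk \<Longrightarrow> uniform_limit K (F \<circ> r) g sequentially"
    by (rule H2_montel [of F B, OF F B]) blast
  have "g z = f z" if "z \<in> disk" for z
    using LIMSEQ_unique [OF g(3) [OF that]] LIMSEQ_subseq_LIMSEQ [OF lim [OF that] g(2)] by (auto simp: o_def)
  then have hol: "f holomorphic_on disk"
    using holomorphic_transform [OF g(1)] by blast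
  have B0: "0 \<le> B" using H2_norm_nonneg [OF F] B order_trans by blast
  have "circle_mean s (\<lambda>z. (cmod (f z))\<^sup>2) \<le> B\<^sup>2" if s: "0 < s" "s < 1" for s
  proof -
    have "sphere 0 s \<subseteq> disk" using s by auto
    then obtain M where M: "0 \<le> M" "\<And>f z. f \<in> H2 \<Longrightarrow> z \<in> sphere 0 s \<Longrightarrow> cmod (f z) \<le> M * H2_norm f"
      using H2_locally_bounded [of "sphere 0 s"] by auto
    have "(\<lambda>n. circle_mean s (\<lambda>z. (cmod (F n z))\<^sup>2)) \<longlonglongrightarrow> circle_mean s (\<lambda>z. (cmod (f z))\<^sup>2)"
      unfolding circle_mean_def
    proof (rule dominated_convergence(2))
      show "(\<lambda>t. (cmod (F n (circlepath 0 s t)))\<^sup>2) integrable_on {0..1}" for n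
        using s by (intro integrable_on_circle [where F="\<lambda>z. (cmod (F n z))\<^sup>2"]
             continuous_on_norm_square H2_holomorphic F) auto
      show "(\<lambda>t::real. (M * B)\<^sup>2) integrable_on {0..1}"
        by (intro integrable_continuous_real continuous_intros)
      show "norm ((cmod (F n (circlepath 0 s t)))\<^sup>2) \<le> (M * B)\<^sup>2" for n t
      proof -
        have "cmod (F n (circlepath 0 s t)) \<le> M * H2_norm (F n)"
          using s by (intro M(2) F) auto
        also have "\<dots> \<le> M * B" by (intro mult_left_mono B M)
        finally show ?thesis by (simp add: power_mono)
      qed
      show "(\<lambda>n. (cmod (F n (circlepath 0 s t)))\<^sup>2) \<longlonglongrightarrow> (cmod (f (circlepath 0 s t)))\<^sup>2" for t
        using s by (intro tendsto_intros lim) auto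
    qed
    moreover have "circle_mean s (\<lambda>z. (cmod (F n z))\<^sup>2) \<le> B\<^sup>2" for n
      using circle_mean_le_H2_norm [OF F s, of n] power_mono [OF B H2_norm_nonneg [OF F], of n 2] by linarith
    ultimately show ?thesis
      by (intro LIMSEQ_le_const2) auto
  qed
  then have "f \<in> H2" "(H2_norm f)\<^sup>2 \<le> B\<^sup>2"
    using H2_family_by_means [of "{()}" "\<lambda>_. f" "B\<^sup>2"] hol by auto
  then show "f \<in> H2" "H2_norm f \<le> B"
    using B0 power2_le_imp_le by auto
qed

section \<open>Compactness for ranges away from the circle\<close>

text \<open>\<open>f \<circ> \<phi>\<close> sees \<open>f\<close> only on the compact disk of radius
  \<rho>. There Montel's theorem gives uniform convergence of a subsequence, and multiplication by
  \<open>w\<close> in \<open>H2\<close> turns it into norm convergence.\<close>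

lemma wcomp_compact:
  assumes \<phi>: "\<phi> holomorphic_on disk" "\<phi> ` disk \<subseteq> disk" and w: "w \<in> H2"
    and \<rho>: "\<rho> < 1" "\<And>z. z \<in> disk \<Longrightarrow> cmod (\<phi> z) \<le> \<rho>"
  shows "H2_compact_op (wcomp w \<phi>)"
proof -
  have sub: "cball 0 \<rho> \<subseteq> disk" using \<rho>(1) by auto
  have wcomp_hol: "wcomp w \<phi> f holomorphic_on disk" if "f holomorphic_on disk" for f
    using holomorphic_on_compose_gen [OF \<phi>(1) that \<phi>(2)] H2_holomorphic [OF w]
    unfolding wcomp_def o_def by (intro holomorphic_intros)
  \<comment> \<open>Stated for holomorphic \<open>f\<close>, so that it covers the limit function
    from Montel's theorem and the differences to it.\<close>
  have bound: "wcomp w \<phi> f \<in> H2 \<and> H2_norm (wcomp w \<phi> f) \<le> M * H2_norm w"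
    if "f holomorphic_on disk" "0 \<le> M" "\<And>z. z \<in> cball 0 \<rho> \<Longrightarrow> cmod (f z) \<le> M" for f M
  proof -
    have "cmod (wcomp w \<phi> f z) \<le> M * cmod (w z)" if "z \<in> disk" for z
      using \<open>\<And>z. z \<in> cball 0 \<rho> \<Longrightarrow> cmod (f z) \<le> M\<close> [of "\<phi> z"] \<rho>(2) [OF that]
      by (simp add: wcomp_def norm_mult mult.commute [of M] mult_left_mono)
    then show ?thesis
      using H2_domination [OF w wcomp_hol [OF that(1)] _ that(2)] by blast
  qed
  have in_H2: "wcomp w \<phi> f \<in> H2" if "f holomorphic_on disk" for f
  proof -
    have "bounded (f ` cball 0 \<rho>)"
      by (intro compact_imp_bounded compact_continuous_image holomorphic_on_imp_continuous_on
          holomorphic_on_subset [OF that sub]) auto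
    then obtain M where "\<And>z. z \<in> cball 0 \<rho> \<Longrightarrow> cmod (f z) \<le> M" "0 < M"
      unfolding bounded_pos by (metis image_eqI)
    then show ?thesis using bound [OF that, of M] by auto
  qed
  have "\<exists>r g. strict_mono r \<and> g \<in> H2 \<and> (\<lambda>n. H2_norm (wcomp w \<phi> (f (r n)) - g)) \<longlonglongrightarrow> 0"
    if f: "\<And>n. f n \<in> H2" and bdd: "bounded (range (\<lambda>n. H2_norm (f n)))" for f :: "nat \<Rightarrow> complex \<Rightarrow> complex"
  proof -
    obtain B where B: "\<And>n. H2_norm (f n) \<le> B"
      using bdd unfolding bounded_iff by (auto simp: abs_le_iff)
    obtain g r where g: "g holomorphic_on disk" "strict_mono (r :: nat \<Rightarrow> nat)"
      "\<And>z. z \<in> disk \<Longrightarrow> (\<lambda>n. f (r n) z) \<longlonglongrightarrow> g z"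
      "\<And>K. compact K \<Longrightarrow> K \<subseteq> disk \<Longrightarrow> uniform_limit K (f \<circ> r) g sequentially"
      by (rule H2_montel [of f B, OF f B]) blast
    have u: "uniform_limit (cball 0 \<rho>) (f \<circ> r) g sequentially"
      using g(4) [OF compact_cball sub] .
    have "(\<lambda>n. H2_norm (wcomp w \<phi> (f (r n)) - wcomp w \<phi> g)) \<longlonglongrightarrow> 0"
    proof (rule LIMSEQ_I)
      fix e :: real assume e: "0 < e"
      define d where "d = e / (2 * (H2_norm w + 1))"
      have w0: "0 \<le> H2_norm w" by (rule H2_norm_nonneg [OF w])
      then have d: "0 < d" "d * H2_norm w < e"
        using e by (auto simp: d_def field_simps intro: add_nonneg_pos)
      from uniform_limitD [OF u d(1)] obtain N
        where N: "\<And>n z. n \<ge> N \<Longrightarrow> z \<in> cball 0 \<rho> \<Longrightarrow> dist ((f \<circ> r) n z) (g z) < d"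
        unfolding eventually_sequentially by blast
      show "\<exists>N. \<forall>n\<ge>N. norm (H2_norm (wcomp w \<phi> (f (r n)) - wcomp w \<phi> g) - 0) < e"
      proof (intro exI allI impI)
        fix n assume n: "N \<le> n"
        let ?h = "\<lambda>z. f (r n) z - g z"
        have eq: "wcomp w \<phi> (f (r n)) - wcomp w \<phi> g = wcomp w \<phi> ?h"
          by (auto simp: wcomp_def algebra_simps)
        have h: "?h holomorphic_on disk"
          by (intro holomorphic_intros g H2_holomorphic f)
        have "cmod (?h z) \<le> d" if "z \<in> cball 0 \<rho>" for z
          using N [OF n that] by (simp add: dist_norm)
        from bound [OF h _ this] d(1)
        have "wcomp w \<phi> ?h \<in> H2" "H2_norm (wcomp w \<phi> ?h) \<le> d * H2_norm w" by auto
        then show "norm (H2_norm (wcomp w \<phi> (f (r n)) - wcomp w \<phi> g) - 0) < e"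
          unfolding eq using d(2) H2_norm_nonneg [of "wcomp w \<phi> ?h"] by simp
      qed
    qed
    then show ?thesis using g(2) in_H2 [OF g(1)] by blast
  qed
  then show ?thesis
    unfolding H2_compact_op_def using in_H2 H2_holomorphic by blast
qed

section \<open>Bumps near a boundary point\<close>

text \<open>With s = 1 - \<kappa> z this is close to 1 where |s| is much smaller than \<delta> and
  close to 0 where |s| is much larger: for |\<kappa>| = 1 a holomorphic cutoff at distance about
  \<delta> from the boundary point \<open>cnj \<kappa>\<close>.\<close>

definition resolvent :: "complex \<Rightarrow> real \<Rightarrow> complex \<Rightarrow> complex" where
  "resolvent \<kappa> \<delta> z = of_real \<delta> / (of_real \<delta> + (1 - \<kappa> * z))"

definition bump :: "complex \<Rightarrow> real \<Rightarrow> real \<Rightarrow> complex \<Rightarrow> complex" where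
  "bump \<kappa> \<delta> \<epsilon> z = resolvent \<kappa> \<delta> z - resolvent \<kappa> \<epsilon> z"

context
  fixes \<kappa> :: complex
  assumes \<kappa>: "cmod \<kappa> = 1"
begin

lemma half_plane:
  assumes "z \<in> disk"
  shows "0 < Re (1 - \<kappa> * z)" "0 < cmod (1 - \<kappa> * z)"
proof -
  have "Re (\<kappa> * z) \<le> cmod (\<kappa> * z)" by (rule complex_Re_le_cmod)
  also have "\<dots> < 1" using assms \<kappa> by (simp add: norm_mult)
  finally show "0 < Re (1 - \<kappa> * z)" by simp
  then show "0 < cmod (1 - \<kappa> * z)" by (metis zero_complex.simps(1) less_irrefl zero_less_norm_iff)
qed

text \<open>Since s = 1 - \<kappa> z has positive real part, adding \<delta> causes no cancellation;
  both \<delta> and |s| survive as lower bounds.\<close>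

lemma resolvent_denominator:
  assumes "z \<in> disk" "0 < \<delta>"
  shows "\<delta> \<le> cmod (of_real \<delta> + (1 - \<kappa> * z))" "cmod (1 - \<kappa> * z) \<le> cmod (of_real \<delta> + (1 - \<kappa> * z))"
    "of_real \<delta> + (1 - \<kappa> * z) \<noteq> 0"
proof -
  let ?s = "1 - \<kappa> * z"
  note Re_pos = half_plane(1) [OF assms(1)]
  have "\<delta> \<le> Re (of_real \<delta> + ?s)" using Re_pos by simp
  then show 1: "\<delta> \<le> cmod (of_real \<delta> + ?s)" by (meson complex_Re_le_cmod order_trans)
  show "of_real \<delta> + ?s \<noteq> 0" using 1 assms(2) by (metis norm_zero not_le)
  have "(Re ?s)\<^sup>2 \<le> (\<delta> + Re ?s)\<^sup>2"
    using Re_pos assms(2) by (intro power_mono) auto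
  then have "(cmod ?s)\<^sup>2 \<le> (cmod (of_real \<delta> + ?s))\<^sup>2"
    unfolding cmod_power2 by simp
  then show "cmod ?s \<le> cmod (of_real \<delta> + ?s)" by (rule power2_le_imp_le) simp
qed

lemma resolvent_holomorphic: "0 < \<delta> \<Longrightarrow> resolvent \<kappa> \<delta> holomorphic_on disk"
  unfolding resolvent_def using resolvent_denominator(3) by (intro holomorphic_intros)

lemma bump_holomorphic: "0 < \<delta> \<Longrightarrow> 0 < \<epsilon> \<Longrightarrow> bump \<kappa> \<delta> \<epsilon> holomorphic_on disk"
  unfolding bump_def by (intro holomorphic_intros resolvent_holomorphic)

lemma one_minus_resolvent:
  assumes "z \<in> disk" "0 < \<delta>"
  shows "cmod (1 - resolvent \<kappa> \<delta> z) \<le> 1" "cmod (1 - resolvent \<kappa> \<delta> z) \<le> cmod (1 - \<kappa> * z) / \<delta>"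
proof -
  note D = resolvent_denominator [OF assms]
  have "1 - resolvent \<kappa> \<delta> z = (1 - \<kappa> * z) / (of_real \<delta> + (1 - \<kappa> * z))"
    using D(3) by (simp add: resolvent_def field_simps)
  then have eq: "cmod (1 - resolvent \<kappa> \<delta> z) = cmod (1 - \<kappa> * z) / cmod (of_real \<delta> + (1 - \<kappa> * z))"
    by (simp add: norm_divide)
  show "cmod (1 - resolvent \<kappa> \<delta> z) \<le> 1"
    unfolding eq using D by (simp add: divide_le_eq_1)
  show "cmod (1 - resolvent \<kappa> \<delta> z) \<le> cmod (1 - \<kappa> * z) / \<delta>"
    unfolding eq using D assms by (intro divide_left_mono mult_pos_pos) auto
qed

text \<open>The bump equals (\<delta> - \<epsilon>) s / ((\<delta> + s) (\<epsilon> + s)). The three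
  bounds differ in the lower bounds taken for the two factors below: \<delta> and |s|, then |s|
  twice, then \<delta> and \<epsilon>. The second is decay outside the shell, the third decay
  towards the boundary point.\<close>

lemma bump_bounds:
  assumes z: "z \<in> disk" and \<epsilon>: "0 < \<epsilon>" "\<epsilon> < \<delta>"
  shows "cmod (bump \<kappa> \<delta> \<epsilon> z) \<le> 1" "cmod (bump \<kappa> \<delta> \<epsilon> z) \<le> \<delta> / cmod (1 - \<kappa> * z)"
    "cmod (bump \<kappa> \<delta> \<epsilon> z) \<le> cmod (1 - \<kappa> * z) / \<epsilon>"
proof -
  let ?s = "1 - \<kappa> * z"
  have \<delta>: "0 < \<delta>" using \<epsilon> by simp
  note D = resolvent_denominator [OF z \<delta>] and E = resolvent_denominator [OF z \<epsilon>(1)]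
  have s: "0 < cmod ?s" using half_plane [OF z] by simp
  have bump: "bump \<kappa> \<delta> \<epsilon> z = of_real (\<delta> - \<epsilon>) * ?s / ((of_real \<delta> + ?s) * (of_real \<epsilon> + ?s))"
    using D(3) E(3) by (simp add: bump_def resolvent_def diff_frac_eq) (simp add: algebra_simps)
  have eq: "cmod (bump \<kappa> \<delta> \<epsilon> z) = ((\<delta> - \<epsilon>) * cmod ?s) / (cmod (of_real \<delta> + ?s) * cmod (of_real \<epsilon> + ?s))"
    unfolding bump norm_divide norm_mult norm_of_real using \<epsilon> by simp
  have le: "cmod (bump \<kappa> \<delta> \<epsilon> z) \<le> (\<delta> * cmod ?s) / (a * b)"
    if "0 < a" "a \<le> cmod (of_real \<delta> + ?s)" "0 < b" "b \<le> cmod (of_real \<epsilon> + ?s)" for a b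
    unfolding eq using that \<epsilon> s by (intro frac_le mult_mono mult_pos_pos) auto
  show "cmod (bump \<kappa> \<delta> \<epsilon> z) \<le> 1"
    using le [of \<delta> "cmod ?s"] D E s \<delta> by simp
  show "cmod (bump \<kappa> \<delta> \<epsilon> z) \<le> \<delta> / cmod ?s"
    using le [of "cmod ?s" "cmod ?s"] D E s \<delta> by simp
  show "cmod (bump \<kappa> \<delta> \<epsilon> z) \<le> cmod ?s / \<epsilon>"
    using le [of \<delta> \<epsilon>] D E s \<delta> \<epsilon> by simp
qed

text \<open>With b = 1 / (1 + \<epsilon>) the resolvent is \<epsilon> b / (1 - b \<kappa> z), a
  geometric series whose squared coefficient moduli sum to \<epsilon> / (2 + \<epsilon>). So the
  norm tends to 0 with \<epsilon> although the value at the boundary point stays 1.\<close>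

lemma resolvent_H2:
  assumes "0 < \<epsilon>"
  shows "resolvent \<kappa> \<epsilon> \<in> H2" "(H2_norm (resolvent \<kappa> \<epsilon>))\<^sup>2 \<le> \<epsilon> / 2"
proof -
  define b where "b = 1 / (1 + \<epsilon>)"
  have b: "0 < b" "b < 1" using assms by (auto simp: b_def)
  have sums: "(\<lambda>n. of_real (\<epsilon> * b) * (of_real b * \<kappa>) ^ n * z ^ n) sums resolvent \<kappa> \<epsilon> z" if "z \<in> disk" for z
  proof -
    have "cmod (of_real b * \<kappa> * z) < 1"
      using b that \<kappa> mult_strict_mono [of b 1 "cmod z" 1] by (simp add: norm_mult)
    then have "(\<lambda>n. of_real (\<epsilon> * b) * (of_real b * \<kappa> * z) ^ n) sums (of_real (\<epsilon> * b) * (1 / (1 - of_real b * \<kappa> * z)))"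
      by (intro sums_mult geometric_sums)
    moreover have "of_real (\<epsilon> * b) * (1 / (1 - of_real b * \<kappa> * z)) = resolvent \<kappa> \<epsilon> z"
    proof -
      have nz: "of_real (1 + \<epsilon>) \<noteq> (0::complex)" using assms by (simp only: of_real_eq_0_iff)
      have "1 - of_real b * \<kappa> * z = (of_real \<epsilon> + (1 - \<kappa> * z)) / of_real (1 + \<epsilon>)"
        using nz by (simp add: b_def field_simps)
      then show ?thesis using nz by (simp add: resolvent_def b_def)
    qed
    ultimately show ?thesis by (simp add: power_mult_distrib mult_ac)
  qed
  have "(\<lambda>n. (cmod (of_real (\<epsilon> * b) * (of_real b * \<kappa>) ^ n))\<^sup>2) = (\<lambda>n. (\<epsilon> * b)\<^sup>2 * (b\<^sup>2) ^ n)"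
    using \<kappa> b assms by (auto simp: norm_mult norm_power power_mult_distrib power_commutes mult_ac simp flip: power_mult)
  moreover have "(\<lambda>n. (\<epsilon> * b)\<^sup>2 * (b\<^sup>2) ^ n) sums ((\<epsilon> * b)\<^sup>2 * (1 / (1 - b\<^sup>2)))"
    using b by (intro sums_mult geometric_sums) (simp add: power_less_one_iff abs_square_less_1)
  ultimately have a: "(\<lambda>n. (cmod (of_real (\<epsilon> * b) * (of_real b * \<kappa>) ^ n))\<^sup>2) sums ((\<epsilon> * b)\<^sup>2 * (1 / (1 - b\<^sup>2)))"
    by simp
  have "(\<epsilon> * b)\<^sup>2 * (1 / (1 - b\<^sup>2)) = \<epsilon> / (2 + \<epsilon>)"
  proof -
    have "1 - b\<^sup>2 = \<epsilon> * (2 + \<epsilon>) * b\<^sup>2"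
    proof -
      have "b * (1 + \<epsilon>) = 1" using assms by (simp add: b_def)
      then have "1 - b\<^sup>2 = (b * (1 + \<epsilon>))\<^sup>2 - b\<^sup>2" by simp
      then show ?thesis by (simp add: algebra_simps power2_eq_square)
    qed
    then show ?thesis using assms b by (simp add: power_mult_distrib power2_eq_square)
  qed
  also have "\<dots> \<le> \<epsilon> / 2" using assms by (intro divide_left_mono) auto
  finally have le: "(\<epsilon> * b)\<^sup>2 * (1 / (1 - b\<^sup>2)) \<le> \<epsilon> / 2" .
  show "resolvent \<kappa> \<epsilon> \<in> H2" "(H2_norm (resolvent \<kappa> \<epsilon>))\<^sup>2 \<le> \<epsilon> / 2"
    using H2_power_series [OF resolvent_holomorphic [OF assms] sums a] order_trans [OF _ le] by blast+
qed

end

section \<open>Density of bounded functions and smallness of resolvent multipliers\<close>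

lemma H2_polynomial_approximation:
  assumes f: "f \<in> H2" and e: "0 < e"
  obtains p M where "p holomorphic_on disk" "\<And>z. z \<in> disk \<Longrightarrow> cmod (p z) \<le> M" "0 \<le> M"
    "(\<lambda>z. f z - p z) \<in> H2" "H2_norm (\<lambda>z. f z - p z) \<le> e"
proof -
  let ?a = "taylor_coeff f"
  have summ: "summable (\<lambda>n. (cmod (?a n))\<^sup>2)" using f by (simp add: H2_def)
  obtain N where N: "norm (\<Sum>n. (cmod (?a (n + N)))\<^sup>2) < e\<^sup>2"
    using suminf_exist_split [OF _ summ, of "e\<^sup>2"] e by auto
  define p where "p = (\<lambda>z. \<Sum>n<N. ?a n * z ^ n)"
  define M where "M = (\<Sum>n<N. cmod (?a n))"
  have p: "p holomorphic_on disk" unfolding p_def by (intro holomorphic_intros)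
  have M: "cmod (p z) \<le> M" if "z \<in> disk" for z
    unfolding p_def M_def
    by (rule order_trans [OF norm_sum], intro sum_mono)
       (use that in \<open>auto simp: norm_mult norm_power intro!: mult_left_le power_le_one\<close>)
  define b where "b = (\<lambda>n. if n < N then 0 else ?a n)"
  have sums: "(\<lambda>n. b n * z ^ n) sums (f z - p z)" if "z \<in> disk" for z
  proof -
    have "(\<lambda>n. ?a n * z ^ n - (if n \<in> {..<N} then ?a n * z ^ n else 0)) sums (f z - p z)"
      unfolding p_def by (intro sums_diff taylor_sums H2_holomorphic f that sums_If_finite_set) auto
    moreover have "(\<lambda>n. ?a n * z ^ n - (if n \<in> {..<N} then ?a n * z ^ n else 0)) = (\<lambda>n. b n * z ^ n)"
      by (auto simp: b_def)
    ultimately show ?thesis by simp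
  qed
  have b: "(\<lambda>n. (cmod (b n))\<^sup>2) sums (\<Sum>n. (cmod (?a (n + N)))\<^sup>2)"
  proof -
    have "(\<lambda>n. (cmod (b (n + N)))\<^sup>2) sums (\<Sum>n. (cmod (?a (n + N)))\<^sup>2)"
      using summable_sums [OF summable_ignore_initial_segment [OF summ, of N]] by (simp add: b_def)
    then show ?thesis by (subst (asm) sums_iff_shift) (simp add: b_def)
  qed
  have hol: "(\<lambda>z. f z - p z) holomorphic_on disk"
    by (intro holomorphic_intros H2_holomorphic f p)
  note D = H2_power_series [OF hol sums b]
  have "(H2_norm (\<lambda>z. f z - p z))\<^sup>2 \<le> e\<^sup>2" using D(2) N by simp
  then have "H2_norm (\<lambda>z. f z - p z) \<le> e" by (rule power2_le_imp_le) (use e in auto)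
  moreover have "0 \<le> M" unfolding M_def by (simp add: sum_nonneg)
  ultimately show thesis using that [OF p M] D(1) by blast
qed

lemma H2_mult_bounded:
  assumes f: "f \<in> H2" and g: "g holomorphic_on disk" "\<And>z. z \<in> disk \<Longrightarrow> cmod (g z) \<le> M" "0 \<le> M"
  shows "(\<lambda>z. g z * f z) \<in> H2" and "H2_norm (\<lambda>z. g z * f z) \<le> M * H2_norm f"
proof -
  have "(\<lambda>z. g z * f z) holomorphic_on disk" by (intro holomorphic_intros g H2_holomorphic f)
  moreover have "cmod (g z * f z) \<le> M * cmod (f z)" if "z \<in> disk" for z
    using g(2) [OF that] by (simp add: norm_mult mult_right_mono)
  ultimately show "(\<lambda>z. g z * f z) \<in> H2" and "H2_norm (\<lambda>z. g z * f z) \<le> M * H2_norm f"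
    using H2_domination [OF f] g(3) by blast+
qed

text \<open>The resolvents are bounded by 1 and tend to 0 in norm with \<epsilon>. Multiplied by a
  bounded \<open>p\<close> near \<open>f\<close> they become small in norm; on the remainder
  \<open>f - p\<close> the bound 1 suffices.\<close>

lemma resolvent_mult_small:
  assumes \<kappa>: "cmod \<kappa> = 1" and f: "f \<in> H2" and e: "0 < e" and \<delta>: "0 < \<delta>"
  obtains \<epsilon> where "0 < \<epsilon>" "\<epsilon> < \<delta>" "H2_norm (\<lambda>z. resolvent \<kappa> \<epsilon> z * f z) \<le> e"
proof -
  obtain p M where p: "p holomorphic_on disk" "\<And>z. z \<in> disk \<Longrightarrow> cmod (p z) \<le> M" "0 \<le> M"
    and fp: "(\<lambda>z. f z - p z) \<in> H2" "H2_norm (\<lambda>z. f z - p z) \<le> e / 2"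
    using H2_polynomial_approximation [OF f, of "e / 2"] e by auto
  \<comment> \<open>Chosen so that the resolvent has norm at most e / (2 (M + 1)), which makes its
    product with \<open>p\<close> at most \<open>e / 2\<close>; the \<open>+ 1\<close> covers
    \<open>M = 0\<close>.\<close>
  define \<epsilon> where "\<epsilon> = min (\<delta> / 2) ((e / (2 * (M + 1)))\<^sup>2)"
  have \<epsilon>: "0 < \<epsilon>" "\<epsilon> < \<delta>" "\<epsilon> \<le> (e / (2 * (M + 1)))\<^sup>2"
    using \<delta> e p(3) by (auto simp: \<epsilon>_def)
  note R = resolvent_H2 [OF \<kappa> \<epsilon>(1)]
  have res1: "cmod (resolvent \<kappa> \<epsilon> z) \<le> 1" if "z \<in> disk" for z
    using resolvent_denominator [OF \<kappa> that \<epsilon>(1)] \<epsilon>(1) by (simp add: resolvent_def norm_divide divide_le_eq_1)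
  have "(H2_norm (resolvent \<kappa> \<epsilon>))\<^sup>2 \<le> (e / (2 * (M + 1)))\<^sup>2"
    using R(2) \<epsilon> by linarith
  then have "H2_norm (resolvent \<kappa> \<epsilon>) \<le> e / (2 * (M + 1))"
    by (rule power2_le_imp_le) (use e p(3) in auto)
  then have "M * H2_norm (resolvent \<kappa> \<epsilon>) \<le> M * (e / (2 * (M + 1)))"
    by (intro mult_left_mono p)
  also have "\<dots> \<le> e / 2" using p(3) e by (simp add: field_simps)
  finally have 1: "M * H2_norm (resolvent \<kappa> \<epsilon>) \<le> e / 2" .
  note A = H2_mult_bounded [OF R(1) p]
  note B = H2_mult_bounded [OF fp(1) resolvent_holomorphic [OF \<kappa> \<epsilon>(1)] res1, simplified]
  have "(\<lambda>z. resolvent \<kappa> \<epsilon> z * f z) = (\<lambda>z. p z * resolvent \<kappa> \<epsilon> z + resolvent \<kappa> \<epsilon> z * (f z - p z))"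
    by (auto simp: algebra_simps)
  then have "H2_norm (\<lambda>z. resolvent \<kappa> \<epsilon> z * f z) \<le> e"
    using H2_add(2) [OF A(1) B(1)] A(2) B(2) 1 fp(2) by auto
  then show thesis using that \<epsilon> by blast
qed

section \<open>Gluing norming weights\<close>

text \<open>Applied to the constant 1, the condition places \<open>v\<close> itself in
  \<open>H2\<close> with norm at most 1, hence bounds all such \<open>v\<close> at a given point by
  one constant.\<close>

definition contractive_weight :: "(complex \<Rightarrow> complex) \<Rightarrow> (complex \<Rightarrow> complex) \<Rightarrow> bool" where
  "contractive_weight \<phi> v \<longleftrightarrow> v holomorphic_on disk \<and>
     (\<forall>f\<in>H2. wcomp v \<phi> f \<in> H2 \<and> H2_norm (wcomp v \<phi> f) \<le> H2_norm f)"

text \<open>Let \<open>N\<close> be the operator norm for the weight \<open>h ^ n\<close>.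
  Evaluating the image of 1 at \<open>z0\<close> gives N \<ge> k |h z0|^n, so
  \<open>h ^ n / N\<close> is at most (\<rho> / |h z0|)^n / k where |h| \<le> \<rho>, and this tends
  to 0. Division by \<open>N\<close> makes the operator norm 1, whence some \<open>f\<close> in the
  unit ball has an image of norm at least 1/2.\<close>

lemma norming_power_weight:
  assumes \<phi>: "\<phi> holomorphic_on disk" "\<phi> ` disk \<subseteq> disk"
    and h: "h holomorphic_on disk" "\<And>z. z \<in> disk \<Longrightarrow> cmod (h z) \<le> 1"
    and \<rho>: "0 \<le> \<rho>" "z0 \<in> disk" "\<rho> < cmod (h z0)" and \<eta>: "0 < \<eta>"
  obtains v f where "contractive_weight \<phi> v"
    "\<And>z. z \<in> disk \<Longrightarrow> cmod (h z) \<le> \<rho> \<Longrightarrow> cmod (v z) \<le> \<eta>"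
    "f \<in> H2" "H2_norm f \<le> 1" "1 / 2 \<le> H2_norm (wcomp v \<phi> f)"
proof -
  \<comment> \<open>The inverse constant of the pointwise bound at \<open>z0\<close>: k |g z0| is at
    most the norm of g.\<close>
  define k where "k = sqrt ((1 - cmod z0) / 4)"
  have k: "0 < k" using \<rho>(2) by (simp add: k_def)
  have h0: "0 < cmod (h z0)" using \<rho> by linarith
  have "(\<lambda>n. (\<rho> / cmod (h z0)) ^ n) \<longlonglongrightarrow> 0"
    using \<rho> h0 by (intro LIMSEQ_power_zero) simp
  then have "eventually (\<lambda>n. (\<rho> / cmod (h z0)) ^ n < \<eta> * k) sequentially"
    using \<eta> k by (intro order_tendstoD(2)) auto
  then obtain n where "(\<rho> / cmod (h z0)) ^ n < \<eta> * k"
    by (meson eventually_sequentially order_refl)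
  then have n: "\<rho> ^ n \<le> \<eta> * (k * cmod (h z0) ^ n)"
    using h0 by (simp add: power_divide divide_less_eq mult.assoc)
  define C where "C = sqrt (4 / (1 - cmod (\<phi> 0)))"
  have \<phi>0: "cmod (\<phi> 0) < 1" using \<phi>(2) by (auto simp: image_subset_iff)
  have C: "0 \<le> C" using \<phi>0 by (simp add: C_def)
  let ?u = "\<lambda>z. h z ^ n"
  have u: "?u holomorphic_on disk" "\<And>z. z \<in> disk \<Longrightarrow> cmod (?u z) \<le> 1"
    using h by (auto intro!: holomorphic_intros simp: norm_power power_le_one)
  have T: "wcomp ?u \<phi> f \<in> H2" "H2_norm (wcomp ?u \<phi> f) \<le> C * H2_norm f" if "f \<in> H2" for f
  proof -
    note L = littlewood_subordination(1) [OF \<phi> that]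
    have "H2_norm (\<lambda>z. f (\<phi> z)) \<le> C * H2_norm f"
      unfolding C_def by (rule composition_norm_le [OF \<phi> that])
    then show "wcomp ?u \<phi> f \<in> H2" "H2_norm (wcomp ?u \<phi> f) \<le> C * H2_norm f"
      unfolding wcomp_def using H2_mult_bounded [OF L u, simplified] by auto
  qed
  define S where "S = {H2_norm (wcomp ?u \<phi> f) |f. f \<in> H2 \<and> H2_norm f \<le> 1}"
  define N where "N = Sup S"
  have bdd: "bdd_above S"
  proof (rule bdd_aboveI [of _ C])
    fix x assume "x \<in> S"
    then obtain f where f: "x = H2_norm (wcomp ?u \<phi> f)" "f \<in> H2" "H2_norm f \<le> 1" by (auto simp: S_def)
    then show "x \<le> C" using T(2) [OF f(2)] mult_left_mono [OF f(3) C] by simp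
  qed
  note one = H2_one
  have lower: "k * cmod (h z0) ^ n \<le> N"
  proof -
    have "H2_norm (wcomp ?u \<phi> (\<lambda>z. 1)) \<in> S" using one by (auto simp: S_def)
    then have "H2_norm (wcomp ?u \<phi> (\<lambda>z. 1)) \<le> N" unfolding N_def by (intro cSup_upper bdd)
    moreover have "k * cmod (h z0) ^ n \<le> H2_norm (wcomp ?u \<phi> (\<lambda>z. 1))"
    proof (rule power2_le_imp_le)
      have "(cmod (h z0 ^ n))\<^sup>2 \<le> 4 / (1 - cmod z0) * (H2_norm (wcomp ?u \<phi> (\<lambda>z. 1)))\<^sup>2"
        using H2_pointwise_bound [OF T(1) [OF one(1)] \<rho>(2)] by (simp add: wcomp_def)
      then show "(k * cmod (h z0) ^ n)\<^sup>2 \<le> (H2_norm (wcomp ?u \<phi> (\<lambda>z. 1)))\<^sup>2"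
        using \<rho>(2) by (simp add: k_def power_mult_distrib norm_power field_simps)
    qed (use H2_norm_nonneg T(1) one in auto)
    ultimately show ?thesis by linarith
  qed
  have N: "0 < N" using lower k h0 by (meson less_le_trans mult_pos_pos zero_less_power)
  have "N / 2 < Sup S" using N by (simp add: N_def)
  moreover have "S \<noteq> {}" using one by (auto simp: S_def)
  ultimately obtain f where f: "f \<in> H2" "H2_norm f \<le> 1" "N / 2 < H2_norm (wcomp ?u \<phi> f)"
    using less_cSup_iff [of S "N / 2"] bdd by (auto simp: S_def)
  \<comment> \<open>The supremum runs over the unit ball; the general case follows by scaling, a
    norm of 0 being settled by the bound with \<open>C\<close>.\<close>
  have TN: "H2_norm (wcomp ?u \<phi> g) \<le> N * H2_norm g" if g: "g \<in> H2" for g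
  proof (cases "H2_norm g = 0")
    case True
    then show ?thesis using T(2) [OF g] by simp
  next
    case False
    define c where "c = H2_norm g"
    have c: "0 < c" using False H2_norm_nonneg [OF g] by (simp add: c_def)
    let ?g = "\<lambda>z. of_real (1 / c) * g z"
    have "?g \<in> H2" "H2_norm ?g \<le> 1"
      using H2_cmult [OF g, of "of_real (1 / c)"] c unfolding norm_of_real by (auto simp: c_def)
    then have *: "wcomp ?u \<phi> ?g \<in> H2" "H2_norm (wcomp ?u \<phi> ?g) \<in> S"
      using T(1) by (blast, unfold S_def, blast)
    have N: "H2_norm (wcomp ?u \<phi> ?g) \<le> N"
      unfolding N_def by (rule cSup_upper [OF *(2) bdd])
    have "wcomp ?u \<phi> g = (\<lambda>z. of_real c * wcomp ?u \<phi> ?g z)"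
      using c by (auto simp: wcomp_def)
    then have "H2_norm (wcomp ?u \<phi> g) \<le> c * H2_norm (wcomp ?u \<phi> ?g)"
      using H2_cmult(2) [OF *(1), of "of_real c"] c by simp
    also have "\<dots> \<le> c * N" using c by (intro mult_left_mono N) auto
    finally show ?thesis by (simp add: c_def mult.commute)
  qed
  define v where "v = (\<lambda>z. of_real (1 / N) * ?u z)"
  have v: "wcomp v \<phi> g = (\<lambda>z. of_real (1 / N) * wcomp ?u \<phi> g z)" for g
    by (auto simp: v_def wcomp_def)
  have nv: "cmod (of_real (1 / N)) = 1 / N" unfolding norm_of_real using N by simp
  show thesis
  proof (rule that [of v f])
    have "H2_norm (wcomp v \<phi> g) \<le> H2_norm g" if "g \<in> H2" for g
    proof -
      have "H2_norm (wcomp v \<phi> g) \<le> 1 / N * H2_norm (wcomp ?u \<phi> g)"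
        unfolding v using H2_cmult(2) [OF T(1) [OF that], of "of_real (1 / N)"] by (simp only: nv)
      also have "\<dots> \<le> 1 / N * (N * H2_norm g)" using N by (intro mult_left_mono TN that) auto
      finally show ?thesis using N by simp
    qed
    moreover have "wcomp v \<phi> g \<in> H2" if "g \<in> H2" for g
      unfolding v by (intro H2_cmult T that)
    moreover have "v holomorphic_on disk" unfolding v_def by (intro holomorphic_intros h)
    ultimately show cv: "contractive_weight \<phi> v" unfolding contractive_weight_def by blast
    show "cmod (v z) \<le> \<eta>" if "z \<in> disk" "cmod (h z) \<le> \<rho>" for z
    proof -
      have "cmod (v z) = cmod (h z) ^ n / N" unfolding v_def norm_mult nv norm_power by simp
      also have "\<dots> \<le> \<rho> ^ n / N" using N that by (intro divide_right_mono power_mono) auto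
      also have "\<dots> \<le> \<eta>"
        using order_trans [OF n mult_left_mono [OF lower]] \<eta> N by (simp add: divide_le_eq)
      finally show ?thesis .
    qed
    have "H2_norm (wcomp ?u \<phi> f) \<le> N * H2_norm (wcomp v \<phi> f)"
    proof -
      have "wcomp ?u \<phi> f = (\<lambda>z. of_real N * wcomp v \<phi> f z)"
        using N by (simp add: wcomp_def v_def)
      moreover have "wcomp v \<phi> f \<in> H2" using cv f(1) by (simp add: contractive_weight_def)
      ultimately show ?thesis using H2_cmult(2) [of "wcomp v \<phi> f" "of_real N"] N
        by (metis abs_of_pos norm_of_real)
    qed
    then have "N * (1 / 2) \<le> N * H2_norm (wcomp v \<phi> f)" using f(3) by simp
    then show "1 / 2 \<le> H2_norm (wcomp v \<phi> f)" using N by (simp only: mult_le_cancel_left_pos)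
  qed (use f in auto)
qed

section \<open>One weight cut down to one shell\<close>

text \<open>The order of choices matters: \<delta> determines how small \<open>v\<close> must be
  away from the boundary point, \<open>v\<close> and its test function \<open>f\<close> come next,
  and \<epsilon> is chosen last, depending on \<open>f\<close>. The bump is cubed because the glued
  weight contains its square and the test function one more factor.\<close>

lemma exists_bump_weight:
  assumes \<phi>: "\<phi> holomorphic_on disk" "\<phi> ` disk \<subseteq> disk" and \<kappa>: "cmod \<kappa> = 1"
    and near: "\<And>e. 0 < e \<Longrightarrow> \<exists>z\<in>disk. cmod (1 - \<kappa> * \<phi> z) < e" and \<delta>: "0 < \<delta>"
  shows "\<exists>\<epsilon> v f. 0 < \<epsilon> \<and> \<epsilon> < \<delta> \<and> contractive_weight \<phi> v \<and> f \<in> H2 \<and> H2_norm f \<le> 1 \<and>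
    1 / 4 \<le> H2_norm (\<lambda>z. v z * bump \<kappa> \<delta> \<epsilon> (\<phi> z) ^ 3 * f (\<phi> z))"
proof -
  have \<phi>disk: "\<phi> z \<in> disk" if "z \<in> disk" for z using \<phi>(2) that by blast
  define C where "C = sqrt (4 / (1 - cmod (\<phi> 0)))"
  have "cmod (\<phi> 0) < 1" using \<phi>disk [of 0] by simp
  then have "1 \<le> 4 / (1 - cmod (\<phi> 0))" by (smt (verit) le_divide_eq_1_pos norm_ge_zero)
  then have C: "1 \<le> C" by (simp add: C_def)
  \<comment> \<open>Calibrated so that the error \<open>X\<close> below has squared norm at most 36
    \<eta>^2 C^2 = (6/100)^2.\<close>
  define \<eta> where "\<eta> = 1 / (100 * C)"
  have \<eta>: "0 < \<eta>" using C by (simp add: \<eta>_def)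
  \<comment> \<open>The threshold for |1 - \<kappa> \<phi>|. Below \<open>t\<close> the factor
    \<open>1 - resolvent\<close> is at most t / \<delta> \<le> \<eta>; from \<open>t\<close> on, |h|
    \<le> \<rho> and so |v| \<le> \<eta>.\<close>
  define t where "t = min 1 (\<eta> * \<delta>)"
  have t: "0 < t" "t \<le> 1" "t \<le> \<eta> * \<delta>" using \<eta> \<delta> by (auto simp: t_def)
  have t2: "0 < t\<^sup>2" "t\<^sup>2 \<le> 1" using t by (auto simp: power_le_one)
  define \<rho> where "\<rho> = sqrt (1 - t\<^sup>2 / 4)"
  have \<rho>: "0 \<le> \<rho>" "\<rho> < 1" "\<rho>\<^sup>2 = 1 - t\<^sup>2 / 4" using t2 by (auto simp: \<rho>_def)
  define h where "h = (\<lambda>z. (1 + \<kappa> * \<phi> z) / 2)"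
  have h: "h holomorphic_on disk" unfolding h_def by (intro holomorphic_intros \<phi>) auto
  \<comment> \<open>The parallelogram law for 1 and \<kappa> \<phi>, the latter of modulus at most
    1. It explains the choice of \<rho>.\<close>
  have h2: "(cmod (h z))\<^sup>2 \<le> 1 - (cmod (1 - \<kappa> * \<phi> z))\<^sup>2 / 4" if "z \<in> disk" for z
  proof -
    have "(cmod (1 + \<kappa> * \<phi> z))\<^sup>2 + (cmod (1 - \<kappa> * \<phi> z))\<^sup>2 = 2 + 2 * (cmod (\<kappa> * \<phi> z))\<^sup>2"
      unfolding cmod_power2 by (simp add: power2_eq_square algebra_simps)
    moreover have "(cmod (\<kappa> * \<phi> z))\<^sup>2 \<le> 1"
      using \<phi>disk [OF that] \<kappa> by (simp add: norm_mult power_le_one)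
    ultimately show ?thesis by (simp add: h_def norm_divide power_divide)
  qed
  have h1: "cmod (h z) \<le> 1" if "z \<in> disk" for z
  proof (rule power2_le_imp_le)
    show "(cmod (h z))\<^sup>2 \<le> 1\<^sup>2" using h2 [OF that] by (smt (verit) one_power2 zero_le_divide_iff zero_le_power2)
  qed simp
  \<comment> \<open>At such a point |h z0| exceeds 1 - (1 - \<rho>) / 2, which is larger than
    \<rho>.\<close>
  obtain z0 where z0: "z0 \<in> disk" "cmod (1 - \<kappa> * \<phi> z0) < 1 - \<rho>"
    using near [of "1 - \<rho>"] \<rho> by auto
  have "h z0 = 1 - (1 - \<kappa> * \<phi> z0) / 2" by (simp add: h_def field_simps)
  then have "1 - cmod ((1 - \<kappa> * \<phi> z0) / 2) \<le> cmod (h z0)"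
    by (metis norm_one norm_triangle_ineq2)
  then have "\<rho> < cmod (h z0)" using z0(2) \<rho> by (simp add: norm_divide)
  then obtain v f where v: "contractive_weight \<phi> v"
    and small: "\<And>z. z \<in> disk \<Longrightarrow> cmod (h z) \<le> \<rho> \<Longrightarrow> cmod (v z) \<le> \<eta>"
    and f: "f \<in> H2" "H2_norm f \<le> 1" "1 / 2 \<le> H2_norm (wcomp v \<phi> f)"
    using norming_power_weight [OF \<phi> h h1 \<rho>(1) z0(1) _ \<eta>] by metis
  obtain \<epsilon> where \<epsilon>: "0 < \<epsilon>" "\<epsilon> < \<delta>" "H2_norm (\<lambda>z. resolvent \<kappa> \<epsilon> z * f z) \<le> 1 / 100"
    using resolvent_mult_small [OF \<kappa> f(1) _ \<delta>, of "1 / 100"] by auto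
  define q where "q = bump \<kappa> \<delta> \<epsilon>"
  define Q where "Q = (\<lambda>z. 1 + q z + (q z)\<^sup>2)"
  have q: "q holomorphic_on disk" unfolding q_def by (intro bump_holomorphic \<kappa> \<delta> \<epsilon>)
  have q1: "cmod (q z) \<le> 1" if "z \<in> disk" for z
    unfolding q_def by (rule bump_bounds [OF \<kappa> that \<epsilon>(1,2)])
  have Q: "Q holomorphic_on disk" unfolding Q_def by (intro holomorphic_intros q)
  have Q3: "cmod (Q z) \<le> 3" if "z \<in> disk" for z
  proof -
    have "cmod (Q z) \<le> cmod 1 + cmod (q z) + cmod ((q z)\<^sup>2)"
      unfolding Q_def by (meson add_right_mono norm_triangle_ineq order_trans)
    also have "\<dots> \<le> 1 + 1 + 1"
      using q1 [OF that] by (intro add_mono) (auto simp: norm_power power_le_one)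
    finally show ?thesis by simp
  qed
  have comp: "(\<lambda>z. g (\<phi> z)) holomorphic_on disk" if "g holomorphic_on disk" for g
    using holomorphic_on_compose_gen [OF \<phi>(1) that \<phi>(2)] by (simp add: o_def)
  have vhol: "v holomorphic_on disk" using v by (simp add: contractive_weight_def)
  have fhol: "f holomorphic_on disk" by (rule H2_holomorphic [OF f(1)])
  \<comment> \<open>\<open>1 = q\<^sup>3 + (1 - q) Q\<close> splits \<open>v (f \<circ> \<phi>)\<close> into the main term \<open>Z\<close> and the two errors made by cutting
    off at the outer radius (\<open>X\<close>) and at the inner radius (\<open>Y\<close>).\<close>
  define X where "X = (\<lambda>z. v z * (1 - resolvent \<kappa> \<delta> (\<phi> z)) * Q (\<phi> z) * f (\<phi> z))"
  define Y where "Y = wcomp v \<phi> (\<lambda>z. Q z * (resolvent \<kappa> \<epsilon> z * f z))"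
  define Z where "Z = (\<lambda>z. v z * q (\<phi> z) ^ 3 * f (\<phi> z))"
  have X: "X \<in> H2" "H2_norm X \<le> 6 / 100"
  proof -
    \<comment> \<open>\<open>X\<close> is dominated by a small multiple of |v (f \<circ> \<phi>)|
      where \<phi> is near the boundary point and of |f \<circ> \<phi>| elsewhere. Listing both as a
      family turns the case distinction into a sum of squares.\<close>
    define F where "F = (\<lambda>i::nat. if i = 0 then wcomp v \<phi> f else (\<lambda>z. f (\<phi> z)))"
    have sum2: "(\<Sum>i<2. g i) = g 0 + g 1" for g :: "nat \<Rightarrow> real"
      by (simp add: numeral_2_eq_2)
    have F: "F i \<in> H2" for i
      using v f(1) littlewood_subordination(1) [OF \<phi> f(1)] by (simp add: F_def contractive_weight_def)
    have Xhol: "X holomorphic_on disk"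
      unfolding X_def by (intro holomorphic_intros vhol comp Q fhol resolvent_holomorphic \<kappa> \<delta>)
    have le: "(\<Sum>j\<in>{()}. (cmod (X z))\<^sup>2) \<le> 18 * \<eta>\<^sup>2 * (\<Sum>i<2. (cmod (F i z))\<^sup>2)" if z: "z \<in> disk" for z
    proof -
      let ?a = "cmod (v z * f (\<phi> z))" and ?b = "cmod (f (\<phi> z))"
      note R = one_minus_resolvent [OF \<kappa> \<phi>disk [OF z] \<delta>]
      have "cmod (v z) * cmod (1 - resolvent \<kappa> \<delta> (\<phi> z)) \<le> \<eta> * cmod (v z) + \<eta>"
      proof (cases "t \<le> cmod (1 - \<kappa> * \<phi> z)")
        case True
        then have "t\<^sup>2 \<le> (cmod (1 - \<kappa> * \<phi> z))\<^sup>2" using t by (intro power_mono) auto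
        then have "(cmod (h z))\<^sup>2 \<le> \<rho>\<^sup>2" using h2 [OF z] \<rho>(3) by linarith
        then have "cmod (v z) \<le> \<eta>" using small [OF z] \<rho>(1) power2_le_imp_le by blast
        then have "cmod (v z) * cmod (1 - resolvent \<kappa> \<delta> (\<phi> z)) \<le> \<eta> * 1"
          using R(1) \<eta> by (intro mult_mono) auto
        then show ?thesis using \<eta> by (smt (verit) mult_nonneg_nonneg norm_ge_zero)
      next
        case False
        then have "cmod (1 - resolvent \<kappa> \<delta> (\<phi> z)) \<le> \<eta>"
          using R(2) t(3) \<delta> by (smt (verit) divide_le_eq)
        then have "cmod (v z) * cmod (1 - resolvent \<kappa> \<delta> (\<phi> z)) \<le> cmod (v z) * \<eta>"
          by (intro mult_left_mono) auto
        then show ?thesis using \<eta> by (simp add: mult.commute)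
      qed
      then have "cmod (X z) \<le> (\<eta> * cmod (v z) + \<eta>) * 3 * cmod (f (\<phi> z))"
        unfolding X_def norm_mult using Q3 [OF \<phi>disk [OF z]] \<eta>
        by (intro mult_right_mono mult_mono) auto
      also have "\<dots> = 3 * \<eta> * (?a + ?b)" by (simp add: norm_mult algebra_simps)
      finally have "(cmod (X z))\<^sup>2 \<le> (3 * \<eta> * (?a + ?b))\<^sup>2" by (intro power_mono) auto
      also have "\<dots> = 9 * \<eta>\<^sup>2 * (?a + ?b)\<^sup>2" by (simp add: power_mult_distrib)
      also have "\<dots> \<le> 9 * \<eta>\<^sup>2 * (2 * (?a\<^sup>2 + ?b\<^sup>2))"
        using sum_squares_bound [of ?a ?b] by (intro mult_left_mono) (auto simp: power2_sum)
      also have "\<dots> = 18 * \<eta>\<^sup>2 * (?a\<^sup>2 + ?b\<^sup>2)" by simp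
      finally show ?thesis by (simp add: F_def wcomp_def sum2)
    qed
    have Xdom: "X \<in> H2" "(H2_norm X)\<^sup>2 \<le> 18 * \<eta>\<^sup>2 * (\<Sum>i<2. (H2_norm (F i))\<^sup>2)"
      using H2_family_domination [of "{..<2::nat}" "{()}" F "\<lambda>_. X" "18 * \<eta>\<^sup>2", OF _ _ F Xhol le] by auto
    show "X \<in> H2" by (rule Xdom)
    have F0: "(H2_norm (F 0))\<^sup>2 \<le> 1"
      using v f F [of 0] H2_norm_nonneg [of "F 0"]
      by (intro power_le_one) (auto simp: F_def contractive_weight_def intro: order_trans)
    have "H2_norm (F 1) \<le> C * H2_norm f"
      using composition_norm_le [OF \<phi> f(1)] by (simp add: F_def C_def)
    also have "\<dots> \<le> C" using C f(2) by (intro mult_left_le) auto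
    finally have F1: "(H2_norm (F 1))\<^sup>2 \<le> C\<^sup>2"
      using H2_norm_nonneg [OF F] by (intro power_mono) auto
    have "(H2_norm X)\<^sup>2 \<le> 18 * \<eta>\<^sup>2 * (1 + C\<^sup>2)"
      using F0 F1 by (intro order_trans [OF Xdom(2)] mult_left_mono) (auto simp: sum2)
    also have "\<dots> \<le> 18 * \<eta>\<^sup>2 * (2 * C\<^sup>2)"
      using C by (intro mult_left_mono) (auto simp: one_le_power)
    also have "\<dots> = (6 / 100)\<^sup>2" using C by (simp add: \<eta>_def power2_eq_square)
    finally show "H2_norm X \<le> 6 / 100" by (rule power2_le_imp_le) simp
  qed
  have res: "(\<lambda>z. resolvent \<kappa> \<epsilon> z * f z) \<in> H2"
  proof (rule H2_mult_bounded(1) [OF f(1) resolvent_holomorphic [OF \<kappa> \<epsilon>(1)], of 2])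
    show "cmod (resolvent \<kappa> \<epsilon> z) \<le> 2" if "z \<in> disk" for z
      using one_minus_resolvent(1) [OF \<kappa> that \<epsilon>(1)] norm_triangle_ineq4 [of 1 "1 - resolvent \<kappa> \<epsilon> z"] by simp
  qed simp
  have Y: "Y \<in> H2" "H2_norm Y \<le> 3 / 100"
  proof -
    note B = H2_mult_bounded [OF res Q Q3, simplified]
    show "Y \<in> H2" using v B(1) by (simp add: Y_def contractive_weight_def)
    have "H2_norm Y \<le> H2_norm (\<lambda>z. Q z * (resolvent \<kappa> \<epsilon> z * f z))"
      using v B(1) by (simp add: Y_def contractive_weight_def)
    then show "H2_norm Y \<le> 3 / 100" using B(2) \<epsilon>(3) by simp
  qed
  have vf: "wcomp v \<phi> f \<in> H2" using v f(1) by (simp add: contractive_weight_def)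
  have eq: "wcomp v \<phi> f z = Z z + (X z + Y z)" for z
  proof -
    have "1 = q (\<phi> z) ^ 3 + (1 - q (\<phi> z)) * Q (\<phi> z)"
      by (simp add: Q_def power3_eq_cube power2_eq_square algebra_simps)
    moreover have "1 - q (\<phi> z) = (1 - resolvent \<kappa> \<delta> (\<phi> z)) + resolvent \<kappa> \<epsilon> (\<phi> z)"
      by (simp add: q_def bump_def)
    ultimately have "v z * 1 * f (\<phi> z) = v z * (q (\<phi> z) ^ 3 +
        ((1 - resolvent \<kappa> \<delta> (\<phi> z)) + resolvent \<kappa> \<epsilon> (\<phi> z)) * Q (\<phi> z)) * f (\<phi> z)" by simp
    then show ?thesis by (simp add: wcomp_def X_def Y_def Z_def algebra_simps)
  qed
  note XY = H2_add [OF X(1) Y(1)]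
  have "Z = (\<lambda>z. wcomp v \<phi> f z - (X z + Y z))" using eq by auto
  then have ZH: "Z \<in> H2" using H2_diff(1) [OF vf XY(1)] by simp
  have "wcomp v \<phi> f = (\<lambda>z. Z z + (X z + Y z))" using eq by auto
  then have "1 / 2 \<le> H2_norm Z + (H2_norm X + H2_norm Y)"
    using H2_add(2) [OF ZH XY(1)] XY(2) f(3) by auto
  then have "1 / 4 \<le> H2_norm Z" using X(2) Y(2) by simp
  then show ?thesis
    unfolding Z_def q_def using \<epsilon> v f by blast
qed

section \<open>Superposition of infinitely many weights\<close>

text \<open>\<open>decay\<close> makes the series for \<open>w\<close> converge and the test
  functions tend to 0 pointwise; \<open>disjoint\<close> bounds the sum of |q j|^2 and makes the
  off-diagonal interactions summably small; \<open>lower\<close> keeps the diagonal terms away from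
  0.\<close>

lemma wcomp_bounded_not_compact:
  fixes q :: "nat \<Rightarrow> complex \<Rightarrow> complex"
  assumes \<phi>: "\<phi> holomorphic_on disk" "\<phi> ` disk \<subseteq> disk"
    and v: "\<And>j. contractive_weight \<phi> (v j)"
    and f: "\<And>j. f j \<in> H2" "\<And>j. H2_norm (f j) \<le> 1"
    and q: "\<And>j. q j holomorphic_on disk" "\<And>j z. z \<in> disk \<Longrightarrow> cmod (q j z) \<le> 1"
    and decay: "\<And>j z. z \<in> disk \<Longrightarrow> cmod (q j z) \<le> A z / 2 ^ j"
    and disjoint: "\<And>i j z. z \<in> disk \<Longrightarrow> i \<noteq> j \<Longrightarrow> cmod (q i z) * cmod (q j z) \<le> 1 / 32 / 2 ^ i"
    and lower: "\<And>j. 1 / 4 \<le> H2_norm (\<lambda>z. v j z * q j (\<phi> z) ^ 3 * f j (\<phi> z))"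
  shows "\<exists>w\<in>H2. H2_bounded_op (wcomp w \<phi>) \<and> \<not> H2_compact_op (wcomp w \<phi>)"
proof -
  have \<phi>disk: "\<phi> z \<in> disk" if "z \<in> disk" for z using \<phi>(2) that by blast
  have vH2: "wcomp (v j) \<phi> g \<in> H2" and vnorm: "H2_norm (wcomp (v j) \<phi> g) \<le> H2_norm g" if "g \<in> H2" for g j
    using v that by (auto simp: contractive_weight_def)
  have vhol: "v j holomorphic_on disk" for j using v by (simp add: contractive_weight_def)
  have halves: "(\<Sum>i\<in>I. 1 / 32 / 2 ^ i) \<le> (1 / 16 :: real)" if "finite I" for I :: "nat set"
  proof -
    have g: "(\<lambda>i. 1 / 32 * (1 / 2) ^ i) sums (1 / 32 * (1 / (1 - 1 / 2)) :: real)"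
      by (intro sums_mult geometric_sums) simp
    have "(\<Sum>i\<in>I. 1 / 32 * (1 / 2) ^ i) \<le> (\<Sum>i. 1 / 32 * (1 / 2) ^ i :: real)"
      using g that by (intro sum_le_suminf) (auto simp: sums_iff)
    then show ?thesis using g by (simp add: sums_iff power_divide)
  qed
  have sq: "(\<Sum>j<J. (cmod (q j z))\<^sup>2) \<le> 3" if z: "z \<in> disk" for J z
  proof (cases "J = 0")
    case False
    \<comment> \<open>Against the largest term every square is at most a product of two distinct terms.\<close>
    let ?S = "(\<lambda>j. cmod (q j z)) ` {..<J}"
    have "Max ?S \<in> ?S" using False by (intro Max_in) (auto simp: lessThan_empty_iff)
    then obtain m where m: "m < J" "Max ?S = cmod (q m z)" by auto
    then have max: "cmod (q j z) \<le> cmod (q m z)" if "j < J" for j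
      using Max_ge [of ?S "cmod (q j z)"] that by auto
    have "(\<Sum>j<J. (cmod (q j z))\<^sup>2) = (cmod (q m z))\<^sup>2 + (\<Sum>j\<in>{..<J} - {m}. (cmod (q j z))\<^sup>2)"
      using m(1) by (intro sum.remove) auto
    also have "(\<Sum>j\<in>{..<J} - {m}. (cmod (q j z))\<^sup>2) \<le> (\<Sum>j\<in>{..<J} - {m}. 1 / 32 / 2 ^ j)"
    proof (rule sum_mono)
      fix j assume j: "j \<in> {..<J} - {m}"
      then have "(cmod (q j z))\<^sup>2 \<le> cmod (q j z) * cmod (q m z)"
        unfolding power2_eq_square by (intro mult_left_mono max) auto
      also have "\<dots> \<le> 1 / 32 / 2 ^ j" using j z by (intro disjoint) auto
      finally show "(cmod (q j z))\<^sup>2 \<le> 1 / 32 / 2 ^ j" .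
    qed
    also have "\<dots> \<le> 1 / 16" by (rule halves) simp
    finally show ?thesis using power_le_one [OF norm_ge_zero q(2) [OF z], of m 2] by simp
  qed simp
  \<comment> \<open>The square is there for Cauchy-Schwarz: one factor
    \<open>q j \<circ> \<phi>\<close> stays outside the operator as a coefficient, the other moves
    inside onto the argument \<open>g\<close>.\<close>
  define u where "u = (\<lambda>j z. v j z * (q j (\<phi> z))\<^sup>2)"
  define W where "W = (\<lambda>J z. \<Sum>j<J. u j z)"
  define w where "w = (\<lambda>z. \<Sum>j. u j z)"
  have W_lim: "(\<lambda>J. W J z) \<longlonglongrightarrow> w z" if z: "z \<in> disk" for z
  proof -
    have A: "0 \<le> A (\<phi> z)" using decay [OF \<phi>disk [OF z], of 0] by (smt (verit) div_by_1 norm_ge_zero power_0)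
    define K where "K = sqrt (4 / (1 - cmod z))"
    have K: "0 \<le> K" using z by (simp add: K_def)
    have vK: "cmod (v j z) \<le> K" for j
    proof (rule power2_le_imp_le)
      have "(cmod (v j z))\<^sup>2 \<le> 4 / (1 - cmod z) * (H2_norm (wcomp (v j) \<phi> (\<lambda>z. 1)))\<^sup>2"
        using H2_pointwise_bound [OF vH2 [OF H2_one(1)] z] by (simp add: wcomp_def)
      also have "\<dots> \<le> 4 / (1 - cmod z) * 1"
        using z vnorm [OF H2_one(1), of j] H2_one(2) H2_norm_nonneg [OF vH2 [OF H2_one(1)], of j]
        by (intro mult_left_mono power_le_one) auto
      finally show "(cmod (v j z))\<^sup>2 \<le> K\<^sup>2" using z by (simp add: K_def)
    qed (rule K)
    have le: "norm (u j z) \<le> K * A (\<phi> z) * (1 / 2) ^ j" for j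
    proof -
      have "(cmod (q j (\<phi> z)))\<^sup>2 \<le> 1 * (A (\<phi> z) / 2 ^ j)"
        unfolding power2_eq_square using q(2) decay \<phi>disk [OF z] by (intro mult_mono) auto
      then have "norm (u j z) \<le> K * (A (\<phi> z) / 2 ^ j)"
        unfolding u_def norm_mult norm_power using vK K by (intro mult_mono) auto
      then show ?thesis by (simp add: power_divide)
    qed
    have "summable (\<lambda>j. K * A (\<phi> z) * (1 / 2) ^ j)"
      by (intro summable_mult summable_geometric) simp
    then have "summable (\<lambda>j. u j z)"
      by (rule summable_comparison_test') (rule le)
    then show ?thesis unfolding W_def w_def by (rule summable_LIMSEQ)
  qed
  have qf: "(\<lambda>z. q j z * g z) \<in> H2" "H2_norm (\<lambda>z. q j z * g z) \<le> H2_norm g" if "g \<in> H2" for j g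
    using H2_mult_bounded [OF that q(1) q(2)] by auto
  have Wcomp: "wcomp (W J) \<phi> g \<in> H2" "H2_norm (wcomp (W J) \<phi> g) \<le> 3 * H2_norm g" if g: "g \<in> H2" for J g
  proof -
    let ?F = "\<lambda>j. wcomp (v j) \<phi> (\<lambda>z. q j z * g z)"
    have F: "?F j \<in> H2" for j by (intro vH2 qf g)
    have hol: "wcomp (W J) \<phi> g holomorphic_on disk"
    proof -
      have c: "(\<lambda>z. k (\<phi> z)) holomorphic_on disk" if "k holomorphic_on disk" for k
        using holomorphic_on_compose_gen [OF \<phi>(1) that \<phi>(2)] by (simp add: o_def)
      show ?thesis unfolding wcomp_def W_def u_def
        by (intro holomorphic_intros vhol c q H2_holomorphic g)
    qed
    \<comment> \<open>Cauchy-Schwarz with the coefficients \<open>q j (\<phi> z)\<close>, whose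
      squared moduli sum to at most 3, decouples the outputs of the different operators.\<close>
    have le: "(\<Sum>i\<in>{()}. (cmod (wcomp (W J) \<phi> g z))\<^sup>2) \<le> 3 * (\<Sum>j<J. (cmod (?F j z))\<^sup>2)" if z: "z \<in> disk" for z
    proof -
      have "cmod (wcomp (W J) \<phi> g z) = cmod (\<Sum>j<J. q j (\<phi> z) * ?F j z)"
        by (simp add: wcomp_def W_def u_def sum_distrib_left power2_eq_square mult_ac)
      also have "\<dots> \<le> (\<Sum>j<J. cmod (q j (\<phi> z)) * cmod (?F j z))"
        by (rule order_trans [OF norm_sum]) (simp add: norm_mult)
      finally have "(cmod (wcomp (W J) \<phi> g z))\<^sup>2 \<le> (\<Sum>j<J. cmod (q j (\<phi> z)) * cmod (?F j z))\<^sup>2"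
        by (intro power_mono) auto
      also have "\<dots> \<le> (\<Sum>j<J. (cmod (q j (\<phi> z)))\<^sup>2) * (\<Sum>j<J. (cmod (?F j z))\<^sup>2)"
        by (rule Cauchy_Schwarz_ineq_sum)
      also have "\<dots> \<le> 3 * (\<Sum>j<J. (cmod (?F j z))\<^sup>2)"
        by (intro mult_right_mono sq \<phi>disk z sum_nonneg) auto
      finally show ?thesis by simp
    qed
    have D: "wcomp (W J) \<phi> g \<in> H2" "(H2_norm (wcomp (W J) \<phi> g))\<^sup>2 \<le> 3 * (\<Sum>j<J. (H2_norm (?F j))\<^sup>2)"
      using H2_family_domination [of "{..<J}" "{()}" ?F "\<lambda>_. wcomp (W J) \<phi> g" 3, OF _ _ F hol le] by auto
    show "wcomp (W J) \<phi> g \<in> H2" by (rule D)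
    \<comment> \<open>The same bound 3, now on the inputs \<open>q j z * g z\<close>; together the
      constants give 9 = 3^2.\<close>
    have le2: "(\<Sum>j<J. (cmod (q j z * g z))\<^sup>2) \<le> 3 * (\<Sum>i\<in>{()}. (cmod (g z))\<^sup>2)" if "z \<in> disk" for z
      using sq [OF that, of J] by (simp add: norm_mult power_mult_distrib mult_right_mono flip: sum_distrib_right)
    have "(\<Sum>j<J. (H2_norm (?F j))\<^sup>2) \<le> (\<Sum>j<J. (H2_norm (\<lambda>z. q j z * g z))\<^sup>2)"
      by (intro sum_mono power_mono vnorm qf g H2_norm_nonneg F)
    also have "\<dots> \<le> 3 * (H2_norm g)\<^sup>2"
      using H2_family_domination(2) [of "{()}" "{..<J}" "\<lambda>_. g" "\<lambda>j z. q j z * g z" 3, OF _ _ _ _ le2]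
        g H2_holomorphic [OF qf(1) [OF g]] by simp
    finally have "(H2_norm (wcomp (W J) \<phi> g))\<^sup>2 \<le> (3 * H2_norm g)\<^sup>2"
      using D(2) by (simp add: power_mult_distrib)
    then show "H2_norm (wcomp (W J) \<phi> g) \<le> 3 * H2_norm g"
      by (rule power2_le_imp_le) (use H2_norm_nonneg [OF g] in simp)
  qed
  \<comment> \<open>The bound is uniform in the number of summands, so \<open>H2_fatou\<close>
    passes it to the limit weight.\<close>
  have wcomp: "wcomp w \<phi> g \<in> H2" "H2_norm (wcomp w \<phi> g) \<le> 3 * H2_norm g" if g: "g \<in> H2" for g
  proof -
    have lim: "(\<lambda>J. wcomp (W J) \<phi> g z) \<longlonglongrightarrow> wcomp w \<phi> g z" if "z \<in> disk" for z
      unfolding wcomp_def by (intro tendsto_intros W_lim that)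
    show "wcomp w \<phi> g \<in> H2"
      by (rule H2_fatou(1) [of "\<lambda>J. wcomp (W J) \<phi> g", OF Wcomp [OF g] lim])
    show "H2_norm (wcomp w \<phi> g) \<le> 3 * H2_norm g"
      by (rule H2_fatou(2) [of "\<lambda>J. wcomp (W J) \<phi> g", OF Wcomp [OF g] lim])
  qed
  have w: "w \<in> H2" using wcomp(1) [OF H2_one(1)] by (simp add: wcomp_def)
  have bdd: "H2_bounded_op (wcomp w \<phi>)"
    unfolding H2_bounded_op_def using wcomp by blast
  \<comment> \<open>The factor \<open>q j\<close> confines the test function to its own shell and
    supplies the third power of \<open>q j\<close> in the diagonal term, as in
    \<open>lower\<close>.\<close>
  define F where "F = (\<lambda>j z. q j z * f j z)"
  have F: "F j \<in> H2" "H2_norm (F j) \<le> 1" for j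
    unfolding F_def using qf [OF f(1)] order_trans [OF qf(2) [OF f(1)] f(2)] by auto
  \<comment> \<open>The diagonal term has norm at least 1/4, and all others together contribute at
    most 1/16.\<close>
  have lowerF: "1 / 8 \<le> H2_norm (wcomp w \<phi> (F j))" for j
  proof -
    define Z where "Z = (\<lambda>z. v j z * q j (\<phi> z) ^ 3 * f j (\<phi> z))"
    have Zeq: "Z = wcomp (u j) \<phi> (F j)"
      by (auto simp: Z_def wcomp_def u_def F_def power2_eq_square power3_eq_cube)
    have term_H2: "wcomp (u i) \<phi> (F j) \<in> H2" for i
    proof -
      have "wcomp (u i) \<phi> (F j) = wcomp (v i) \<phi> (\<lambda>z. q i z * (q i z * F j z))"
        by (auto simp: wcomp_def u_def power2_eq_square)
      then show ?thesis by (auto intro!: vH2 qf F)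
    qed
    have small: "H2_norm (wcomp (u i) \<phi> (F j)) \<le> 1 / 32 / 2 ^ i" if "i \<noteq> j" for i
    proof -
      let ?g = "\<lambda>z. (q i z)\<^sup>2 * q j z"
      have "cmod (?g z) \<le> 1 / 32 / 2 ^ i" if z: "z \<in> disk" for z
      proof -
        have "cmod (?g z) = cmod (q i z) * (cmod (q i z) * cmod (q j z))"
          by (simp add: norm_mult norm_power power2_eq_square)
        also have "\<dots> \<le> 1 * (1 / 32 / 2 ^ i)"
          using z \<open>i \<noteq> j\<close> by (intro mult_mono q disjoint) auto
        finally show ?thesis by simp
      qed
      moreover have "?g holomorphic_on disk" by (intro holomorphic_intros q)
      ultimately have G: "(\<lambda>z. ?g z * f j z) \<in> H2" "H2_norm (\<lambda>z. ?g z * f j z) \<le> 1 / 32 / 2 ^ i * H2_norm (f j)"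
        using H2_mult_bounded [OF f(1) [of j], of ?g "1 / 32 / 2 ^ i"] by auto
      have "H2_norm (wcomp (u i) \<phi> (F j)) = H2_norm (wcomp (v i) \<phi> (\<lambda>z. ?g z * f j z))"
        by (simp add: wcomp_def u_def F_def mult_ac)
      also have "\<dots> \<le> 1 / 32 / 2 ^ i * H2_norm (f j)"
        using vnorm [OF G(1)] G(2) by (rule order_trans)
      also have "\<dots> \<le> 1 / 32 / 2 ^ i" by (intro mult_left_le f) auto
      finally show ?thesis .
    qed
    \<comment> \<open>The off-diagonal part of a partial sum. The shift \<open>J + Suc j\<close>
      ensures that the index \<open>j\<close> is in range for every \<open>J\<close>.\<close>
    define R where "R = (\<lambda>J z. \<Sum>i\<in>{..<J + Suc j} - {j}. wcomp (u i) \<phi> (F j) z)"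
    have R: "R J \<in> H2" "H2_norm (R J) \<le> 1 / 16" for J
    proof -
      have *: "R J \<in> H2 \<and> H2_norm (R J) \<le> (\<Sum>i\<in>{..<J + Suc j} - {j}. H2_norm (wcomp (u i) \<phi> (F j)))"
        unfolding R_def by (rule H2_sum) (auto intro: term_H2)
      have "(\<Sum>i\<in>{..<J + Suc j} - {j}. H2_norm (wcomp (u i) \<phi> (F j))) \<le> (\<Sum>i\<in>{..<J + Suc j} - {j}. 1 / 32 / 2 ^ i)"
        by (intro sum_mono small) auto
      also have "\<dots> \<le> 1 / 16" by (rule halves) simp
      finally show "R J \<in> H2" "H2_norm (R J) \<le> 1 / 16" using * by auto
    qed
    have R_eq: "R J z = wcomp (W (J + Suc j)) \<phi> (F j) z - Z z" for J z
    proof -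
      have "wcomp (W (J + Suc j)) \<phi> (F j) z = (\<Sum>i<J + Suc j. wcomp (u i) \<phi> (F j) z)"
        unfolding wcomp_def W_def by (rule sum_distrib_right)
      also have "\<dots> = wcomp (u j) \<phi> (F j) z + R J z"
        unfolding R_def by (rule sum.remove) auto
      finally show ?thesis by (simp add: Zeq)
    qed
    have "(\<lambda>J. R J z) \<longlonglongrightarrow> wcomp w \<phi> (F j) z - Z z" if "z \<in> disk" for z
      unfolding R_eq unfolding wcomp_def
      by (intro tendsto_intros LIMSEQ_ignore_initial_segment [OF W_lim [OF that]])
    from H2_fatou [of R, OF R this]
    have D: "(\<lambda>z. wcomp w \<phi> (F j) z - Z z) \<in> H2" "H2_norm (\<lambda>z. wcomp w \<phi> (F j) z - Z z) \<le> 1 / 16" by auto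
    have "H2_norm Z \<le> H2_norm (wcomp w \<phi> (F j)) + H2_norm (\<lambda>z. wcomp w \<phi> (F j) z - Z z)"
      using H2_diff(2) [OF wcomp(1) [OF F(1) [of j]] D(1)] by simp
    then show ?thesis using lower [of j] D(2) unfolding Z_def by simp
  qed
  \<comment> \<open>Norm convergence implies pointwise convergence, so any limit of a subsequence of
    the images must vanish on the disk, which contradicts \<open>lowerF\<close>.\<close>
  have pointwise: "(\<lambda>j. wcomp w \<phi> (F j) z) \<longlonglongrightarrow> 0" if z: "z \<in> disk" for z
  proof -
    define K where "K = sqrt (4 / (1 - cmod (\<phi> z)))"
    have K: "0 \<le> K" using \<phi>disk [OF z] by (simp add: K_def)
    have fK: "cmod (f j (\<phi> z)) \<le> K" for j
    proof (rule power2_le_imp_le)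
      have "(cmod (f j (\<phi> z)))\<^sup>2 \<le> 4 / (1 - cmod (\<phi> z)) * (H2_norm (f j))\<^sup>2"
        by (rule H2_pointwise_bound [OF f(1) \<phi>disk [OF z]])
      also have "\<dots> \<le> 4 / (1 - cmod (\<phi> z)) * 1"
        using \<phi>disk [OF z] f H2_norm_nonneg [OF f(1)] by (intro mult_left_mono power_le_one) auto
      finally show "(cmod (f j (\<phi> z)))\<^sup>2 \<le> K\<^sup>2" using \<phi>disk [OF z] by (simp add: K_def)
    qed (rule K)
    have "norm (wcomp w \<phi> (F j) z) \<le> cmod (w z) * A (\<phi> z) * K * (1 / 2) ^ j" for j
    proof -
      have "norm (wcomp w \<phi> (F j) z) = cmod (w z) * (cmod (q j (\<phi> z)) * cmod (f j (\<phi> z)))"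
        by (simp add: wcomp_def F_def norm_mult)
      also have "\<dots> \<le> cmod (w z) * (A (\<phi> z) / 2 ^ j * K)"
        using K order_trans [OF norm_ge_zero decay [OF \<phi>disk [OF z]]]
        by (intro mult_left_mono mult_mono decay fK \<phi>disk z) auto
      finally show ?thesis by (simp add: power_divide)
    qed
    moreover have "(\<lambda>j. cmod (w z) * A (\<phi> z) * K * (1 / 2) ^ j) \<longlonglongrightarrow> 0"
      by (intro tendsto_mult_right_zero LIMSEQ_power_zero) simp
    ultimately show ?thesis by (rule Lim_null_comparison [OF always_eventually [OF allI]])
  qed
  have "\<not> H2_compact_op (wcomp w \<phi>)"
  proof
    assume "H2_compact_op (wcomp w \<phi>)"
    moreover have "bounded (range (\<lambda>n. H2_norm (F n)))"
      unfolding bounded_iff using F H2_norm_nonneg [OF F(1)] by (intro exI [of _ 1]) auto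
    ultimately obtain r g where r: "strict_mono (r :: nat \<Rightarrow> nat)" and g: "g \<in> H2"
      and lim: "(\<lambda>n. H2_norm (wcomp w \<phi> (F (r n)) - g)) \<longlonglongrightarrow> 0"
      unfolding H2_compact_op_def using F(1) by blast
    have diff: "wcomp w \<phi> (F (r n)) - g = (\<lambda>z. wcomp w \<phi> (F (r n)) z - g z)" for n by auto
    have dH2: "wcomp w \<phi> (F (r n)) - g \<in> H2" for n
      unfolding diff by (intro H2_diff wcomp F g)
    have g0: "g z = 0" if z: "z \<in> disk" for z
    proof -
      have "(\<lambda>n. (cmod (wcomp w \<phi> (F (r n)) z - g z))\<^sup>2) \<longlonglongrightarrow> 0"
      proof (rule Lim_null_comparison [OF always_eventually [OF allI]])
        show "norm ((cmod (wcomp w \<phi> (F (r n)) z - g z))\<^sup>2) \<le> 4 / (1 - cmod z) * (H2_norm (wcomp w \<phi> (F (r n)) - g))\<^sup>2" for n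
          using H2_pointwise_bound [OF dH2 z, of n] by simp
        have "(\<lambda>n. 4 / (1 - cmod z) * (H2_norm (wcomp w \<phi> (F (r n)) - g))\<^sup>2) \<longlonglongrightarrow> 4 / (1 - cmod z) * 0\<^sup>2"
          by (intro tendsto_intros lim)
        then show "(\<lambda>n. 4 / (1 - cmod z) * (H2_norm (wcomp w \<phi> (F (r n)) - g))\<^sup>2) \<longlonglongrightarrow> 0" by simp
      qed
      moreover have "(\<lambda>n. (cmod (wcomp w \<phi> (F (r n)) z - g z))\<^sup>2) \<longlonglongrightarrow> (cmod (0 - g z))\<^sup>2"
        using LIMSEQ_subseq_LIMSEQ [OF pointwise [OF z] r] by (intro tendsto_intros) (simp add: o_def)
      ultimately show ?thesis using LIMSEQ_unique by fastforce
    qed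
    \<comment> \<open>\<open>g\<close> is known to vanish only on the disk, so the norms are
      compared by \<open>H2_cong\<close>.\<close>
    have "H2_norm (wcomp w \<phi> (F (r n)) - g) = H2_norm (wcomp w \<phi> (F (r n)))" for n
      by (rule H2_cong(2) [OF wcomp(1) [OF F(1)]]) (simp add: g0)
    then have "1 / 8 \<le> H2_norm (wcomp w \<phi> (F (r n)) - g)" for n using lowerF by simp
    then have "1 / 8 \<le> (0::real)" using lim by (intro LIMSEQ_le_const) auto
    then show False by simp
  qed
  then show ?thesis using w bdd by blast
qed

section \<open>The equivalence and the choice of shells\<close>

theorem theorem6p2:
  fixes \<phi> :: "complex \<Rightarrow> complex"
  assumes "\<phi> holomorphic_on disk" and "\<phi> ` disk \<subseteq> disk"
  shows "(\<exists>w\<in>H2. H2_bounded_op (wcomp w \<phi>) \<and> \<not> H2_compact_op (wcomp w \<phi>))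
         \<longleftrightarrow> (SUP z\<in>disk. cmod (\<phi> z)) = 1"
proof
  have lt: "cmod (\<phi> z) < 1" if "z \<in> disk" for z
    using assms(2) that by (auto simp: image_subset_iff)
  have bdd: "bdd_above ((\<lambda>z. cmod (\<phi> z)) ` disk)"
    using lt by (intro bdd_aboveI2 [of _ _ 1]) (auto simp: less_imp_le)
  show "(SUP z\<in>disk. cmod (\<phi> z)) = 1"
    if ex: "\<exists>w\<in>H2. H2_bounded_op (wcomp w \<phi>) \<and> \<not> H2_compact_op (wcomp w \<phi>)"
  proof (rule antisym)
    show "(SUP z\<in>disk. cmod (\<phi> z)) \<le> 1"
      using lt by (intro cSUP_least) (auto simp: less_imp_le)
    show "1 \<le> (SUP z\<in>disk. cmod (\<phi> z))"
    proof (rule ccontr)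
      \<comment> \<open>The supremum itself serves as the radius of a closed disk containing the
        range, so every weight in \<open>H2\<close> would give a compact operator.\<close>
      assume "\<not> 1 \<le> (SUP z\<in>disk. cmod (\<phi> z))"
      then show False
        using wcomp_compact [OF assms, of _ "SUP z\<in>disk. cmod (\<phi> z)"] cSUP_upper [OF _ bdd] ex by force
    qed
  qed
  show "\<exists>w\<in>H2. H2_bounded_op (wcomp w \<phi>) \<and> \<not> H2_compact_op (wcomp w \<phi>)"
    if sup: "(SUP z\<in>disk. cmod (\<phi> z)) = 1"
  proof -
    \<comment> \<open>\<kappa> is the conjugate of a point \<zeta> of largest modulus in the closure
      of the range; |\<zeta>| = 1 because the supremum is 1, and |1 - \<kappa> \<phi> z| = |\<phi> z
      - \<zeta>|.\<close>
    obtain \<kappa> where \<kappa>: "cmod \<kappa> = 1" and near: "\<And>e. 0 < e \<Longrightarrow> \<exists>z\<in>disk. cmod (1 - \<kappa> * \<phi> z) < e"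
    proof -
      have comp: "compact (closure (\<phi> ` disk))"
        unfolding compact_closure using assms(2) bounded_subset bounded_ball by blast
      obtain \<zeta> where \<zeta>: "\<zeta> \<in> closure (\<phi> ` disk)" "\<And>x. x \<in> closure (\<phi> ` disk) \<Longrightarrow> cmod x \<le> cmod \<zeta>"
      proof -
        have "closure (\<phi> ` disk) \<noteq> {}" by simp
        then show ?thesis
          using continuous_attains_sup [OF comp, of cmod] continuous_on_norm [OF continuous_on_id] that
          by blast
      qed
      have "closure (\<phi> ` disk) \<subseteq> cball 0 1"
      proof (rule closure_minimal)
        show "\<phi> ` disk \<subseteq> cball 0 1"
          using assms(2) ball_subset_cball by (rule order_trans)
      qed simp
      then have le: "cmod \<zeta> \<le> 1" using \<zeta>(1) mem_cball_0 by blast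
      have "1 \<le> cmod \<zeta>"
      proof -
        have "cmod (\<phi> z) \<le> cmod \<zeta>" if "z \<in> disk" for z
          using \<zeta>(2) closure_subset that by blast
        then have "(SUP z\<in>disk. cmod (\<phi> z)) \<le> cmod \<zeta>" by (intro cSUP_least) auto
        then show ?thesis using sup by simp
      qed
      with le have \<zeta>1: "cmod \<zeta> = 1" by simp
      show thesis
      proof (rule that [of "cnj \<zeta>"])
        show "cmod (cnj \<zeta>) = 1" using \<zeta>1 by simp
        show "\<exists>z\<in>disk. cmod (1 - cnj \<zeta> * \<phi> z) < e" if e: "0 < e" for e
        proof -
          obtain z where z: "z \<in> disk" "dist (\<phi> z) \<zeta> < e"
            using \<zeta>(1) e unfolding closure_approachable by blast
          have "1 - cnj \<zeta> * \<phi> z = cnj \<zeta> * (\<zeta> - \<phi> z)"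
            using complex_norm_square [of \<zeta>] \<zeta>1 by (simp add: algebra_simps)
          then have "cmod (1 - cnj \<zeta> * \<phi> z) = cmod (\<phi> z - \<zeta>)"
            using \<zeta>1 by (simp add: norm_mult norm_minus_commute)
          then show ?thesis using z by (intro bexI [of _ z]) (auto simp: dist_norm)
        qed
      qed
    qed
    \<comment> \<open>Packing \<epsilon>, \<open>v\<close> and \<open>f\<close> into one triple
      yields a single choice function of \<delta>, from which the radii are built by
      recursion.\<close>
    define good where "good = (\<lambda>\<delta> (\<epsilon>, v, f). 0 < \<epsilon> \<and> \<epsilon> < \<delta> \<and> contractive_weight \<phi> v \<and> f \<in> H2 \<and>
      H2_norm f \<le> 1 \<and> 1 / 4 \<le> H2_norm (\<lambda>z. v z * bump \<kappa> \<delta> \<epsilon> (\<phi> z) ^ 3 * f (\<phi> z)))"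
    have "\<forall>\<delta>. \<exists>x. 0 < \<delta> \<longrightarrow> good \<delta> x"
      using exists_bump_weight [OF assms \<kappa> near] unfolding good_def by fastforce
    then obtain pick where pick: "\<And>\<delta>. 0 < \<delta> \<Longrightarrow> good \<delta> (pick \<delta>)" by metis
    define E where "E = (\<lambda>\<delta>. fst (pick \<delta>))"
    define V where "V = (\<lambda>\<delta>. fst (snd (pick \<delta>)))"
    define G where "G = (\<lambda>\<delta>. snd (snd (pick \<delta>)))"
    have E: "0 < E \<delta>" "E \<delta> < \<delta>" and V: "contractive_weight \<phi> (V \<delta>)"
      and G: "G \<delta> \<in> H2" "H2_norm (G \<delta>) \<le> 1"
      and lower: "1 / 4 \<le> H2_norm (\<lambda>z. V \<delta> z * bump \<kappa> \<delta> (E \<delta>) (\<phi> z) ^ 3 * G \<delta> (\<phi> z))"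
      if "0 < \<delta>" for \<delta>
      using pick [OF that] by (auto simp: good_def E_def V_def G_def split: prod.splits)
    \<comment> \<open>The next outer radius lies far inside the previous inner radius
      \<open>E d\<close>. The power of 2 carries the new index, as the interaction bound
      \<open>1 / 32 / 2 ^ j\<close> requires; these bounds sum to 1/16 over all indices.\<close>
    define \<delta> where "\<delta> = rec_nat 1 (\<lambda>j d. E d / 32 / 2 ^ Suc j)"
    have \<delta>_0: "\<delta> 0 = 1" and \<delta>_Suc: "\<delta> (Suc j) = E (\<delta> j) / 32 / 2 ^ Suc j" for j
      by (simp_all add: \<delta>_def)
    have \<delta>: "0 < \<delta> j" for j
      by (induction j) (simp_all add: \<delta>_0 \<delta>_Suc E)
    have dec: "\<delta> (Suc j) \<le> E (\<delta> j)" for j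
    proof -
      have "(1::real) \<le> 32 * 2 ^ Suc j" using one_le_power [of "2::real" "Suc j"] by linarith
      then have "E (\<delta> j) * 1 \<le> E (\<delta> j) * (32 * 2 ^ Suc j)"
        using E(1) [OF \<delta> [of j]] by (intro mult_left_mono) auto
      then show ?thesis unfolding \<delta>_Suc by (simp add: divide_le_eq mult_ac)
    qed
    \<comment> \<open>The inner radii decrease along the sequence, so it is enough to compare with
      the predecessor \<open>k\<close> of \<open>j\<close>.\<close>
    have gap: "\<delta> j / E (\<delta> i) \<le> 1 / 32 / 2 ^ j" if ij: "i < j" for i j
    proof -
      obtain k where k: "j = Suc k" "i \<le> k" using ij by (metis less_Suc_eq_le lessE)
      have "E (\<delta> (Suc n)) \<le> E (\<delta> n)" for n
        using dec [of n] E(2) [OF \<delta> [of "Suc n"]] by linarith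
      then have "E (\<delta> k) \<le> E (\<delta> i)" using k(2) by (rule lift_Suc_antimono_le)
      then have "\<delta> j \<le> 1 / 32 / 2 ^ j * E (\<delta> i)"
        unfolding k(1) \<delta>_Suc by (simp add: field_simps)
      then show ?thesis using E(1) [OF \<delta> [of i]] by (simp add: divide_le_eq)
    qed
    have \<delta>_le: "\<delta> j \<le> 1 / 2 ^ j" for j
    proof (cases j)
      case (Suc k)
      have "\<delta> k \<le> 1"
      proof (induction k)
        case (Suc k)
        then show ?case using dec [of k] E(2) [OF \<delta> [of k]] by linarith
      qed (simp add: \<delta>_0)
      then have "E (\<delta> k) \<le> 1" using E(2) [OF \<delta> [of k]] by linarith
      then have "E (\<delta> k) / 32 / 2 ^ Suc k \<le> 1 / 2 ^ Suc k"
        using E(1) [OF \<delta> [of k]] by (intro divide_right_mono) auto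
      then show ?thesis by (simp add: Suc \<delta>_Suc)
    qed (simp add: \<delta>_0)
    define q where "q = (\<lambda>j. bump \<kappa> (\<delta> j) (E (\<delta> j)))"
    note qb = bump_bounds [OF \<kappa> _ E(1) [OF \<delta>] E(2) [OF \<delta>]]
    show ?thesis
    proof (rule wcomp_bounded_not_compact [OF assms, where v="\<lambda>j. V (\<delta> j)" and f="\<lambda>j. G (\<delta> j)" and q=q
          and A="\<lambda>z. 1 / cmod (1 - \<kappa> * z)"])
      show "q j holomorphic_on disk" for j
        unfolding q_def by (intro bump_holomorphic \<kappa> E \<delta>)
      show "cmod (q j z) \<le> 1" if "z \<in> disk" for j z
        unfolding q_def by (rule qb(1) [OF that])
      show "cmod (q j z) \<le> 1 / cmod (1 - \<kappa> * z) / 2 ^ j" if "z \<in> disk" for j z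
      proof -
        have "cmod (q j z) \<le> \<delta> j / cmod (1 - \<kappa> * z)" unfolding q_def by (rule qb(2) [OF that])
        also have "\<dots> \<le> 1 / 2 ^ j / cmod (1 - \<kappa> * z)" by (intro divide_right_mono \<delta>_le) auto
        finally show ?thesis by (simp add: mult.commute)
      qed
      \<comment> \<open>The bound of \<open>q i\<close> towards the boundary point, |s| /
        \<epsilon>, times the bound of \<open>q j\<close> away from it, \<delta> / |s|: the unknown
        |s| cancels and the ratio in \<open>gap\<close> remains.\<close>
      have prod: "cmod (q i z) * cmod (q j z) \<le> 1 / 32 / 2 ^ j" if z: "z \<in> disk" and "i < j" for i j z
      proof -
        have s: "0 < cmod (1 - \<kappa> * z)" using half_plane [OF \<kappa> z] by simp
        have "cmod (q i z) * cmod (q j z) \<le> cmod (1 - \<kappa> * z) / E (\<delta> i) * (\<delta> j / cmod (1 - \<kappa> * z))"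
          unfolding q_def using s E [OF \<delta> [of i]] by (intro mult_mono qb z) auto
        also have "\<dots> = \<delta> j / E (\<delta> i)" using s by simp
        also have "\<dots> \<le> 1 / 32 / 2 ^ j" by (rule gap) fact
        finally show ?thesis .
      qed
      show "cmod (q i z) * cmod (q j z) \<le> 1 / 32 / 2 ^ i" if z: "z \<in> disk" and "i \<noteq> j" for i j z
      proof (cases "i < j")
        case True
        have "(2::real) ^ i \<le> 2 ^ j" using True by (intro power_increasing) auto
        then have "1 / 32 / 2 ^ j \<le> (1 / 32 / 2 ^ i :: real)" by (intro divide_left_mono) auto
        then show ?thesis using prod [OF z True] by linarith
      next
        case False
        then show ?thesis using prod [OF z, of j i] that(2) by (simp add: mult.commute)
      qed
      show "1 / 4 \<le> H2_norm (\<lambda>z. V (\<delta> j) z * q j (\<phi> z) ^ 3 * G (\<delta> j) (\<phi> z))" for j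
        unfolding q_def by (rule lower [OF \<delta>])
    qed (intro V G \<delta>)+
  qed
qed

end
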